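(* Let $K$ be a bounded convex symmetric domain in $\mathbb{R}^2$ that is irreducible and is not a parallelogram. Then there is a continuous map $\phi:[0,1]\to X_2$ which descends to a homeomorphism $\mathbb{S}^1\to\mathcal{L}(K)$; that is, $\phi(0)=\phi(1)$, $\phi([0,1])=\mathcal{L}(K)$, and the induced map from $\mathbb{S}^1=[0,1]/(0\sim 1)$ to $\mathcal{L}(K)$ is a homeomorphism.
   Context: A domain in $\mathbb{R}^2$ is a non-empty connected open set; a domain $K$ is symmetric if $K=-K$ (symmetric about the origin). A lattice in $\mathbb{R}^2$ is a set of the form $\Lambda=g\mathbb{Z}^2$ with $g\in\operatorname{GL}_2(\mathbb{R})$; its covolume is $d(\Lambda)=|\det g|$, which is independent of the choice of $g$. The space $X_2$ of all lattices in $\mathbb{R}^2$ is identified with $\operatorname{GL}_2(\mathbb{R})/\operatorname{GL}_2(\mathbb{Z})$ and carries the quotient topology. Let $K$ be a bounded convex symmetric domain in $\mathbb{R}^2$. A lattice $\Lambda$ is $K$-admissible if $\Lambda\cap K=\{0\}$. The critical determinant of $K$ is $\Delta(K)=\inf\{d(\Lambda):\Lambda \text{ is } K\text{-admissible}\}$. A lattice is $K$-critical if it is $K$-admissible and $d(\Lambda)=\Delta(K)$. The critical locus $\mathcal{L}(K)\subset X_2$ is the set of all $K$-critical lattices, with the subspace topology. $K$ is irreducible if every bounded convex symmetric domain $H\subsetneq K$ satisfies $\Delta(H)<\Delta(K)$. *)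

theory Defs
  imports "HOL-Analysis.Analysis"
begin

definition quotient_topology :: "'a topology \<Rightarrow> ('a \<Rightarrow> 'b) \<Rightarrow> 'b topology" where
  "quotient_topology X q =
     topology (\<lambda>U. U \<subseteq> q ` topspace X \<and> openin X {x \<in> topspace X. q x \<in> U})"

lemma openin_quotient_topology:
  "openin (quotient_topology X q) U \<longleftrightarrow>
     U \<subseteq> q ` topspace X \<and> openin X {x \<in> topspace X. q x \<in> U}"
proof -
  have "istopology (\<lambda>U. U \<subseteq> q ` topspace X \<and> openin X {x \<in> topspace X. q x \<in> U})"
    unfolding istopology_def
  proof (intro conjI allI impI)
    fix S T
    assume S: "S \<subseteq> q ` topspace X \<and> openin X {x \<in> topspace X. q x \<in> S}"
      and T: "T \<subseteq> q ` topspace X \<and> openin X {x \<in> topspace X. q x \<in> T}"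
    show "S \<inter> T \<subseteq> q ` topspace X" using S by blast
    have "{x \<in> topspace X. q x \<in> S \<inter> T} =
        {x \<in> topspace X. q x \<in> S} \<inter> {x \<in> topspace X. q x \<in> T}" by blast
    then show "openin X {x \<in> topspace X. q x \<in> S \<inter> T}" using S T by auto
  next
    fix \<K>
    assume K: "\<forall>U\<in>\<K>. U \<subseteq> q ` topspace X \<and> openin X {x \<in> topspace X. q x \<in> U}"
    show "\<Union>\<K> \<subseteq> q ` topspace X" using K by blast
    have "{x \<in> topspace X. q x \<in> \<Union>\<K>} = (\<Union>U\<in>\<K>. {x \<in> topspace X. q x \<in> U})" by blast
    then show "openin X {x \<in> topspace X. q x \<in> \<Union>\<K>}" using K by auto
  qed
  then show ?thesis by (simp add: quotient_topology_def)
qed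

lemma topspace_quotient_topology [simp]:
  "topspace (quotient_topology X q) = q ` topspace X"
proof
  show "topspace (quotient_topology X q) \<subseteq> q ` topspace X"
    using openin_topspace[of "quotient_topology X q"] by (simp only: openin_quotient_topology)
  have "{x \<in> topspace X. q x \<in> q ` topspace X} = topspace X" by blast
  then have "openin (quotient_topology X q) (q ` topspace X)"
    by (simp add: openin_quotient_topology)
  then show "q ` topspace X \<subseteq> topspace (quotient_topology X q)" by (rule openin_subset)
qed

lemma quotient_map_quotient_topology: "quotient_map X (quotient_topology X q) q"
  by (simp add: quotient_map_def openin_quotient_topology)

definition int_vectors :: "(real^2) set" where
  "int_vectors = {x. \<forall>i. x $ i \<in> \<int>}"

definition lattice_of :: "real^2^2 \<Rightarrow> (real^2) set" where
  "lattice_of g = (\<lambda>x. g *v x) ` int_vectors"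

definition is_lattice :: "(real^2) set \<Rightarrow> bool" where
  "is_lattice \<Lambda> \<longleftrightarrow> (\<exists>g. invertible g \<and> \<Lambda> = lattice_of g)"

text \<open>Two matrices span the same lattice exactly when they lie in the same coset of
  \<open>GL\<^sub>2(\<int>)\<close>, so the quotient topology along \<^const>\<open>lattice_of\<close> is that of
  \<open>GL\<^sub>2(\<real>)/GL\<^sub>2(\<int>)\<close>, transported to the set of lattices.\<close>

definition lattice_space :: "(real^2) set topology" where
  "lattice_space = quotient_topology (top_of_set {g :: real^2^2. invertible g}) lattice_of"

lemma topspace_lattice_space: "topspace lattice_space = {\<Lambda>. is_lattice \<Lambda>}"
  by (auto simp: lattice_space_def is_lattice_def)

definition covolume :: "(real^2) set \<Rightarrow> real" where
  "covolume \<Lambda> = (THE d. \<exists>g. invertible g \<and> \<Lambda> = lattice_of g \<and> d = \<bar>det g\<bar>)"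

lemma lattice_of_subset_det_le:
  assumes g: "invertible g" and h: "invertible h" and sub: "lattice_of g \<subseteq> lattice_of h"
  shows "\<bar>det h\<bar> \<le> \<bar>det g\<bar>"
proof -
  obtain h' where h': "h ** h' = mat 1" "h' ** h = mat 1"
    using h by (auto simp: invertible_def)
  define M where "M = h' ** g"
  have hM: "h ** M = g"
    using h'(1) by (simp add: M_def matrix_mul_assoc)
  have "M $ i $ j \<in> \<int>" for i j
  proof -
    have "axis j 1 \<in> int_vectors" by (auto simp: int_vectors_def axis_def)
    then have "g *v axis j 1 \<in> lattice_of h" using sub by (auto simp: lattice_of_def)
    then obtain z where z: "z \<in> int_vectors" "g *v axis j 1 = h *v z"
      by (auto simp: lattice_of_def)
    have "M *v axis j 1 = h' *v (g *v axis j 1)"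
      by (simp add: M_def matrix_vector_mul_assoc)
    also have "\<dots> = z"
      using h'(2) by (simp add: z matrix_vector_mul_assoc)
    finally have "column j M = z" by (simp add: matrix_vector_mul_component matrix_vector_mult_basis)
    then have "M $ i $ j = z $ i" by (auto simp: column_def)
    then show ?thesis using z by (simp add: int_vectors_def)
  qed
  then have int: "det M \<in> \<int>" by (simp add: det_2)
  have prod: "det g = det h * det M" using det_mul[of h M] hM by simp
  then have "det M \<noteq> 0" using g by (auto simp: invertible_det_nz)
  then have "1 \<le> \<bar>det M\<bar>" using int by (rule Ints_nonzero_abs_ge1[rotated])
  then have "\<bar>det h\<bar> * 1 \<le> \<bar>det h\<bar> * \<bar>det M\<bar>" by (intro mult_left_mono) auto
  then show ?thesis by (simp add: prod abs_mult)
qed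

lemma covolume_lattice_of:
  assumes "invertible g"
  shows "covolume (lattice_of g) = \<bar>det g\<bar>"
  unfolding covolume_def
proof (rule the_equality)
  show "\<exists>h. invertible h \<and> lattice_of g = lattice_of h \<and> \<bar>det g\<bar> = \<bar>det h\<bar>"
    using assms by blast
next
  fix d
  assume "\<exists>h. invertible h \<and> lattice_of g = lattice_of h \<and> d = \<bar>det h\<bar>"
  then show "d = \<bar>det g\<bar>"
    using assms lattice_of_subset_det_le by (metis order_antisym order_refl)
qed

definition bounded_convex_symmetric_domain :: "(real^2) set \<Rightarrow> bool" where
  "bounded_convex_symmetric_domain K \<longleftrightarrow>
     open K \<and> connected K \<and> K \<noteq> {} \<and> bounded K \<and> convex K \<and> K = uminus ` K"

definition admissible :: "(real^2) set \<Rightarrow> (real^2) set \<Rightarrow> bool" where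
  "admissible K \<Lambda> \<longleftrightarrow> is_lattice \<Lambda> \<and> \<Lambda> \<inter> K = {0}"

definition critical_determinant :: "(real^2) set \<Rightarrow> real" where
  "critical_determinant K = Inf {covolume \<Lambda> | \<Lambda>. admissible K \<Lambda>}"

definition critical :: "(real^2) set \<Rightarrow> (real^2) set \<Rightarrow> bool" where
  "critical K \<Lambda> \<longleftrightarrow> admissible K \<Lambda> \<and> covolume \<Lambda> = critical_determinant K"

definition critical_locus :: "(real^2) set \<Rightarrow> (real^2) set set" where
  "critical_locus K = {\<Lambda>. critical K \<Lambda>}"

definition irreducible_domain :: "(real^2) set \<Rightarrow> bool" where
  "irreducible_domain K \<longleftrightarrow>
     (\<forall>H. bounded_convex_symmetric_domain H \<and> H \<subset> K \<longrightarrow>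
        critical_determinant H < critical_determinant K)"

text \<open>Domains are open, so a parallelogram here is taken without its boundary.\<close>

definition open_parallelogram :: "(real^2) set \<Rightarrow> bool" where
  "open_parallelogram P \<longleftrightarrow>
     (\<exists>a u v. u \<noteq> v \<and> independent {u, v} \<and>
        P = {a + s *\<^sub>R u + t *\<^sub>R v | s t. 0 < s \<and> s < 1 \<and> 0 < t \<and> t < 1})"

end

theory Submission
  imports Defs
begin

text \<open>
  Let \<open>N\<close> be the norm with open unit disc \<open>K\<close> and \<open>D\<close> the critical determinant. Critical lattices
  are described by inscribed hexagons \<open>P, Q, Q - P, - P, - Q, P - Q\<close> with all vertices on the boundary.
  The lattice spanned by such a hexagon is always admissible (\<open>hex_admissible\<close>), and reducing an
  admissible lattice to a shortest vector shows that some hexagon has determinant at most its covolume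
  (\<open>admissible_obtain_hex\<close>). So \<open>D\<close> is the least determinant of an inscribed hexagon; a hexagon of
  determinant \<open>D\<close> is called critical.

  Irreducibility enters only once: cutting a tiny cap off at an extreme point of the closed disc lowers the
  critical determinant, and in the limit the hexagons responsible for this become a critical hexagon with
  that extreme point as a vertex (\<open>extreme_point_hex\<close>). Critical hexagons interlace: if
  \<open>\<theta>\<^sub>1 < \<theta>\<^sub>2\<close> are angles of vertices, the next vertices \<open>\<eta>\<^sub>1, \<eta>\<^sub>2\<close> satisfy \<open>\<eta>\<^sub>1 \<le> \<eta>\<^sub>2\<close>
  (\<open>crit_mono\<close>). Suppose that some boundary points are not vertices of critical hexagons, and take a maximal
  arc of them. By interlacing, the two arcs that follow it in the hexagons at its ends contain no vertices of
  critical hexagons either. The three arcs contain no extreme points, hence are segments. Interpolating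
  linearly between the two hexagons gives inscribed hexagons of determinant at most \<open>D\<close>, which fill the arc: a
  contradiction (\<open>gap_empty\<close>). So every boundary point is a vertex of a critical hexagon.

  If a chord of critical height were part of an edge in a way that leaves its position undetermined, moving
  the vertex \<open>P\<close> in both directions and comparing with a supporting line at \<open>P\<close> would show that
  \<open>K\<close> is a parallelogram (\<open>no_flat_point\<close>). Hence the critical hexagon through a boundary point is unique, and
  every critical lattice arises from one. The map \<open>\<tau>\<close> that sends the angle of a vertex to the angle of the next
  vertex satisfies \<open>\<tau>\<^sup>3(\<theta>) = \<theta> + \<pi>\<close>, which makes it an increasing homeomorphism of the line, and the critical
  lattices are its orbits. A fundamental domain is \<open>[0, \<tau>(0)]\<close> with its ends identified, which is a circle.
\<close>

section \<open>Planar lattices and the determinant form\<close>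

definition wedge :: "real^2 \<Rightarrow> real^2 \<Rightarrow> real" where
  "wedge x y = x $ 1 * y $ 2 - x $ 2 * y $ 1"

definition lat :: "real^2 \<Rightarrow> real^2 \<Rightarrow> (real^2) set" where
  "lat P Q = {of_int m *\<^sub>R P + of_int n *\<^sub>R Q | m n :: int. True}"

lemma bilinear_wedge: "bilinear wedge"
  unfolding bilinear_def
  by (auto intro!: linearI simp: wedge_def algebra_simps)

lemmas wedge_simps = bilinear_ladd[OF bilinear_wedge] bilinear_radd[OF bilinear_wedge]
  bilinear_lsub[OF bilinear_wedge] bilinear_rsub[OF bilinear_wedge]
  bilinear_lmul[OF bilinear_wedge] bilinear_rmul[OF bilinear_wedge]
  bilinear_lneg[OF bilinear_wedge] bilinear_rneg[OF bilinear_wedge]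
  bilinear_lzero[OF bilinear_wedge] bilinear_rzero[OF bilinear_wedge]

lemma wedge_self [simp]: "wedge x x = 0"
  by (simp add: wedge_def)

lemma wedge_commute: "wedge y x = - wedge x y"
  by (simp add: wedge_def)

lemma continuous_on_wedge [continuous_intros]:
  "continuous_on S f \<Longrightarrow> continuous_on S g \<Longrightarrow> continuous_on S (\<lambda>x. wedge (f x) (g x))"
  unfolding wedge_def by (intro continuous_intros)

lemma tendsto_wedge [tendsto_intros]:
  "(f \<longlongrightarrow> a) F \<Longrightarrow> (g \<longlongrightarrow> b) F \<Longrightarrow> ((\<lambda>x. wedge (f x) (g x)) \<longlongrightarrow> wedge a b) F"
  unfolding wedge_def by (intro tendsto_intros)

lemma wedge_cramer: "wedge P Q *\<^sub>R X = wedge X Q *\<^sub>R P + wedge P X *\<^sub>R Q"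
  by (auto simp: vec_eq_iff forall_2 wedge_def algebra_simps)

lemma wedge_expand:
  assumes "wedge P Q \<noteq> 0"
  shows "X = (wedge X Q / wedge P Q) *\<^sub>R P + (wedge P X / wedge P Q) *\<^sub>R Q"
proof -
  have "X = (1 / wedge P Q) *\<^sub>R (wedge P Q *\<^sub>R X)" using assms by simp
  also have "\<dots> = (1 / wedge P Q) *\<^sub>R (wedge X Q *\<^sub>R P + wedge P X *\<^sub>R Q)"
    by (subst wedge_cramer) (rule refl)
  finally show ?thesis by (simp add: scaleR_add_right)
qed

lemma wedge_eq_0_imp_scale:
  assumes "wedge P X = 0" "P \<noteq> 0"
  obtains c where "X = c *\<^sub>R P"
proof -
  have "P $ 1 \<noteq> 0 \<or> P $ 2 \<noteq> 0" using assms(2) by (auto simp: vec_eq_iff forall_2)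
  then show thesis
  proof
    assume "P $ 1 \<noteq> 0"
    then have "X = (X $ 1 / P $ 1) *\<^sub>R P"
      using assms(1) by (auto simp: vec_eq_iff forall_2 wedge_def field_simps)
    then show thesis by (rule that)
  next
    assume "P $ 2 \<noteq> 0"
    then have "X = (X $ 2 / P $ 2) *\<^sub>R P"
      using assms(1) by (auto simp: vec_eq_iff forall_2 wedge_def field_simps)
    then show thesis by (rule that)
  qed
qed

text \<open>Lattices are handled through a basis; \<open>cols\<close> translates a basis into the matrix that spans the lattice.\<close>

definition cols :: "real^2 \<Rightarrow> real^2 \<Rightarrow> real^2^2" where
  "cols P Q = (\<chi> i j. if j = 1 then P $ i else Q $ i)"

lemma det_cols: "det (cols P Q) = wedge P Q"
  by (simp add: det_2 cols_def wedge_def algebra_simps)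

lemma cols_column: "cols (column 1 g) (column 2 g) = g"
  by (auto simp: cols_def column_def vec_eq_iff forall_2)

lemma cols_mult: "cols P Q *v x = x $ 1 *\<^sub>R P + x $ 2 *\<^sub>R Q"
  by (auto simp: cols_def vec_eq_iff forall_2 matrix_vector_mult_def sum_2)

lemma lattice_of_cols: "lattice_of (cols P Q) = lat P Q"
proof -
  show ?thesis
  proof
    show "lattice_of (cols P Q) \<subseteq> lat P Q"
      unfolding lattice_of_def
    proof safe
      fix x :: "real^2" assume "x \<in> int_vectors"
      then obtain m n :: int where "x $ 1 = of_int m" "x $ 2 = of_int n"
        by (auto simp: int_vectors_def forall_2 elim!: Ints_cases)
      then show "cols P Q *v x \<in> lat P Q" by (simp add: cols_mult lat_def) blast
    qed
    show "lat P Q \<subseteq> lattice_of (cols P Q)"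
    proof
      fix y assume "y \<in> lat P Q"
      then obtain m n :: int where y: "y = of_int m *\<^sub>R P + of_int n *\<^sub>R Q"
        by (auto simp: lat_def)
      let ?x = "vector [of_int m, of_int n] :: real^2"
      have "?x \<in> int_vectors" by (simp add: int_vectors_def forall_2)
      moreover have "cols P Q *v ?x = y" by (simp add: cols_mult y)
      ultimately show "y \<in> lattice_of (cols P Q)" unfolding lattice_of_def by (metis image_eqI)
    qed
  qed
qed

lemma lattice_of_eq_lat: "lattice_of g = lat (column 1 g) (column 2 g)"
  by (metis cols_column lattice_of_cols)

lemma invertible_cols: "invertible (cols P Q) \<longleftrightarrow> wedge P Q \<noteq> 0"
  by (simp add: invertible_det_nz det_cols)

lemma is_lattice_lat: "wedge P Q \<noteq> 0 \<Longrightarrow> is_lattice (lat P Q)"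
  unfolding is_lattice_def by (metis invertible_cols lattice_of_cols)

lemma covolume_lat: "wedge P Q \<noteq> 0 \<Longrightarrow> covolume (lat P Q) = \<bar>wedge P Q\<bar>"
  by (metis invertible_cols lattice_of_cols det_cols covolume_lattice_of)

lemma is_lattice_obtain_lat:
  assumes "is_lattice \<Lambda>"
  obtains P Q where "\<Lambda> = lat P Q" "wedge P Q \<noteq> 0"
  using assms unfolding is_lattice_def
  by (metis cols_column invertible_cols lattice_of_eq_lat)

lemma lat_memI: "of_int m *\<^sub>R P + of_int n *\<^sub>R Q \<in> lat P Q"
  by (auto simp: lat_def)

lemma lat_basis_mem: "P \<in> lat P Q" "Q \<in> lat P Q"
  using lat_memI[of 1 P 0 Q] lat_memI[of 0 P 1 Q] by auto

lemma lat_zero: "0 \<in> lat P Q"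
  using lat_memI[of 0 P 0 Q] by auto

lemma lat_add: "x \<in> lat P Q \<Longrightarrow> y \<in> lat P Q \<Longrightarrow> x + y \<in> lat P Q"
proof -
  assume "x \<in> lat P Q" "y \<in> lat P Q"
  then obtain m n m' n' :: int where "x = of_int m *\<^sub>R P + of_int n *\<^sub>R Q"
      "y = of_int m' *\<^sub>R P + of_int n' *\<^sub>R Q"
    by (auto simp: lat_def)
  then have "x + y = of_int (m + m') *\<^sub>R P + of_int (n + n') *\<^sub>R Q"
    by (simp add: algebra_simps)
  then show ?thesis by (simp only: lat_memI)
qed

lemma lat_scale: "x \<in> lat P Q \<Longrightarrow> of_int k *\<^sub>R x \<in> lat P Q"
proof -
  assume "x \<in> lat P Q"
  then obtain m n :: int where "x = of_int m *\<^sub>R P + of_int n *\<^sub>R Q"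
    by (auto simp: lat_def)
  then have "of_int k *\<^sub>R x = of_int (k * m) *\<^sub>R P + of_int (k * n) *\<^sub>R Q"
    by (simp add: algebra_simps)
  then show ?thesis by (simp only: lat_memI)
qed

lemma lat_subset: "A \<in> lat P Q \<Longrightarrow> B \<in> lat P Q \<Longrightarrow> lat A B \<subseteq> lat P Q"
proof
  fix x assume "A \<in> lat P Q" "B \<in> lat P Q" "x \<in> lat A B"
  then obtain m n :: int where "x = of_int m *\<^sub>R A + of_int n *\<^sub>R B"
    by (auto simp: lat_def)
  then show "x \<in> lat P Q" using \<open>A \<in> lat P Q\<close> \<open>B \<in> lat P Q\<close> lat_add lat_scale by metis
qed

lemma lat_minus: "x \<in> lat P Q \<Longrightarrow> - x \<in> lat P Q"
  using lat_scale[of x P Q "-1"] by simp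

lemma lat_diff: "x \<in> lat P Q \<Longrightarrow> y \<in> lat P Q \<Longrightarrow> x - y \<in> lat P Q"
  using lat_add[of x P Q "-y"] lat_minus[of y P Q] by simp

lemma lat_eqI: "A \<in> lat P Q \<Longrightarrow> B \<in> lat P Q \<Longrightarrow> P \<in> lat A B \<Longrightarrow> Q \<in> lat A B \<Longrightarrow> lat A B = lat P Q"
  by (intro equalityI lat_subset)

lemma lat_rotate: "lat Q (Q - P) = lat P Q"
proof (rule lat_eqI)
  show "P \<in> lat Q (Q - P)" using lat_diff[OF lat_basis_mem(1,2), of Q "Q - P"] by simp
qed (auto intro: lat_basis_mem lat_diff)

text \<open>The matrix expressing \<open>A, B\<close> in \<open>P, Q\<close> is integral with determinant \<open>\<plusminus>1\<close>, so its inverse, given by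
  Cramer's rule, is integral as well.\<close>

lemma lat_eq_if_wedge_eq:
  assumes A: "A \<in> lat P Q" and B: "B \<in> lat P Q"
    and w: "\<bar>wedge A B\<bar> = \<bar>wedge P Q\<bar>" "wedge P Q \<noteq> 0"
  shows "lat A B = lat P Q"
proof -
  obtain a b c d :: int where ab: "A = of_int a *\<^sub>R P + of_int b *\<^sub>R Q"
    and cd: "B = of_int c *\<^sub>R P + of_int d *\<^sub>R Q"
    using A B by (auto simp: lat_def)
  define e where "e = a * d - b * c"
  have "wedge A B = of_int e * wedge P Q"
    by (simp add: ab cd wedge_simps e_def wedge_commute[of Q P] algebra_simps)
  then have "\<bar>of_int e\<bar> = (1::real)" using w by (auto simp: abs_mult)
  then have e1: "\<bar>e\<bar> = 1" by linarith
  then have ee: "of_int e * of_int e = (1::real)"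
    by (auto simp: abs_if split: if_splits)
  have "of_int d *\<^sub>R A - of_int b *\<^sub>R B = of_int e *\<^sub>R P"
       "of_int a *\<^sub>R B - of_int c *\<^sub>R A = of_int e *\<^sub>R Q"
    by (simp_all add: ab cd e_def algebra_simps)
  then have "of_int e *\<^sub>R P \<in> lat A B" "of_int e *\<^sub>R Q \<in> lat A B"
    using lat_diff[OF lat_scale[OF lat_basis_mem(1)[of A B], of d] lat_scale[OF lat_basis_mem(2)[of B A], of b]]
      lat_diff[OF lat_scale[OF lat_basis_mem(2)[of B A], of a] lat_scale[OF lat_basis_mem(1)[of A B], of c]]
    by simp_all
  then have "of_int e *\<^sub>R of_int e *\<^sub>R P \<in> lat A B" "of_int e *\<^sub>R of_int e *\<^sub>R Q \<in> lat A B"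
    by (blast intro: lat_scale)+
  then show ?thesis using A B ee by (intro lat_eqI) simp_all
qed

section \<open>Planar norms and symmetric convex domains\<close>

locale plane_norm =
  fixes N :: "real^2 \<Rightarrow> real"
  assumes triangle: "N (x + y) \<le> N x + N y"
    and scale: "N (c *\<^sub>R x) = \<bar>c\<bar> * N x"
    and pos: "x \<noteq> 0 \<Longrightarrow> 0 < N x"
begin

abbreviation disc :: "(real^2) set" where "disc \<equiv> {x. N x < 1}"

lemma N_zero [simp]: "N 0 = 0"
  using scale[of 0 0] by simp

lemma N_minus [simp]: "N (- x) = N x"
  using scale[of "-1" x] by simp

lemma N_nonneg: "0 \<le> N x"
  using pos[of x] by (cases "x = 0") auto

lemma N_diff_commute: "N (x - y) = N (y - x)"
  by (metis N_minus minus_diff_eq)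

lemma N_diff_le: "N (x - y) \<le> N x + N y"
  using triangle[of x "-y"] by simp

lemma N_diff_ge: "\<bar>N x - N y\<bar> \<le> N (x - y)"
  using triangle[of "x - y" y] triangle[of "y - x" x] N_diff_commute[of x y] by auto

lemma N_comb: "0 \<le> a \<Longrightarrow> 0 \<le> b \<Longrightarrow> N (a *\<^sub>R x + b *\<^sub>R y) \<le> a * N x + b * N y"
  using triangle[of "a *\<^sub>R x" "b *\<^sub>R y"] by (simp add: scale)

lemma N_le_norm: obtains C where "0 < C" "\<And>x. N x \<le> C * norm x"
proof
  let ?C = "N (axis 1 1) + N (axis 2 1)"
  show "0 < ?C" by (intro add_pos_pos pos) (auto simp: axis_eq_0_iff)
  fix x :: "real^2"
  have "x = (x $ 1) *\<^sub>R axis 1 1 + (x $ 2) *\<^sub>R axis 2 1"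
    by (auto simp: vec_eq_iff forall_2 axis_def)
  then have "N x \<le> \<bar>x $ 1\<bar> * N (axis 1 1) + \<bar>x $ 2\<bar> * N (axis 2 1)"
    by (metis triangle scale)
  also have "\<dots> \<le> norm x * N (axis 1 1) + norm x * N (axis 2 1)"
    by (intro add_mono mult_right_mono component_le_norm_cart N_nonneg)
  finally show "N x \<le> ?C * norm x" by (simp add: algebra_simps)
qed

lemma continuous_on_N: "continuous_on S N"
proof -
  obtain C where C: "0 < C" "\<And>x. N x \<le> C * norm x" using N_le_norm by blast
  have "C-lipschitz_on S N"
    unfolding lipschitz_on_def
  proof (intro conjI ballI)
    show "0 \<le> C" using C by simp
    fix x y :: "real^2"
    have "dist (N x) (N y) \<le> N (x - y)" using N_diff_ge by (simp add: dist_real_def)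
    also have "\<dots> \<le> C * dist x y" using C by (simp add: dist_norm)
    finally show "dist (N x) (N y) \<le> C * dist x y" .
  qed
  then show ?thesis by (rule lipschitz_on_continuous_on)
qed

lemma continuous_on_N_comp [continuous_intros]:
  "continuous_on S f \<Longrightarrow> continuous_on S (\<lambda>x. N (f x))"
  using continuous_on_compose2[OF continuous_on_N[of UNIV]] by auto

lemma tendsto_N [tendsto_intros]: "(f \<longlongrightarrow> a) F \<Longrightarrow> ((\<lambda>x. N (f x)) \<longlongrightarrow> N a) F"
  using continuous_on_N[of UNIV] continuous_on_tendsto_compose by fastforce

lemma N_ge_norm: obtains c where "0 < c" "\<And>x. c * norm x \<le> N x"
proof -
  have "\<exists>x\<in>sphere 0 1. \<forall>y\<in>sphere 0 1. N x \<le> N (y::real^2)"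
    by (intro continuous_attains_inf continuous_on_N) auto
  then obtain u :: "real^2" where u: "norm u = 1" "\<And>y. norm y = 1 \<Longrightarrow> N u \<le> N y"
    by auto
  have "N u * norm x \<le> N x" for x
  proof (cases "x = 0")
    case False
    then have "N u \<le> N ((1 / norm x) *\<^sub>R x)" by (intro u) simp
    then show ?thesis using False by (simp add: scale field_simps)
  qed simp
  moreover have "0 < N u" using u(1) by (intro pos) auto
  ultimately show thesis by (rule that[rotated])
qed

lemma bounded_N_le: "bounded {x. N x \<le> r}"
proof -
  obtain c where c: "0 < c" "\<And>x. c * norm x \<le> N x" using N_ge_norm by blast
  have "norm x \<le> r / c" if "N x \<le> r" for x
    using c(2)[of x] that c(1) by (simp add: field_simps)
  then show ?thesis by (auto simp: bounded_iff)
qed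

lemma compact_N_le: "compact {x. N x \<le> r}"
  by (simp add: compact_eq_bounded_closed bounded_N_le closed_Collect_le continuous_on_N
      continuous_on_const)

lemma convex_N_le: "convex {x. N x \<le> r}"
proof (rule convexI)
  fix x y :: "real^2" and u v :: real
  assume *: "x \<in> {x. N x \<le> r}" "y \<in> {x. N x \<le> r}" "0 \<le> u" "0 \<le> v" "u + v = 1"
  have "N (u *\<^sub>R x + v *\<^sub>R y) \<le> u * N x + v * N y" using * by (intro N_comb)
  also have "\<dots> \<le> u * r + v * r" using * by (intro add_mono mult_left_mono) auto
  also have "\<dots> = r" using \<open>u + v = 1\<close> by (metis distrib_right mult_1)
  finally show "u *\<^sub>R x + v *\<^sub>R y \<in> {x. N x \<le> r}" by simp
qed

lemma convex_disc: "convex disc"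
proof (rule convexI)
  fix x y :: "real^2" and u v :: real
  assume *: "x \<in> disc" "y \<in> disc" "0 \<le> u" "0 \<le> v" "u + v = 1"
  have "N (u *\<^sub>R x + v *\<^sub>R y) \<le> u * N x + v * N y" using * by (intro N_comb)
  also have "\<dots> < 1" using * by (intro convex_bound_lt) auto
  finally show "u *\<^sub>R x + v *\<^sub>R y \<in> disc" by simp
qed

lemma disc_domain: "bounded_convex_symmetric_domain disc"
  unfolding bounded_convex_symmetric_domain_def
proof (intro conjI)
  show "open disc" by (intro open_Collect_less continuous_on_N continuous_on_const)
  show "convex disc" by (rule convex_disc)
  then show "connected disc" by (rule convex_connected)
  have "0 \<in> disc" by simp
  then show "disc \<noteq> {}" by blast
  show "bounded disc" by (rule bounded_subset[OF bounded_N_le[of 1]]) auto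
  show "disc = uminus ` disc"
    by (auto simp: image_iff intro!: exI[of _ "- _"])
qed

text \<open>Separate \<open>p\<close> from the open disc. As the disc is a neighbourhood of \<open>0\<close>, the separating functional is positive at
  \<open>p\<close> and can be normalised there; homogeneity turns its bound on the disc into a bound by \<open>N\<close>.\<close>

lemma support_functional:
  assumes "N p = 1"
  obtains a where "a \<bullet> p = 1" "\<And>x. a \<bullet> x \<le> N x"
proof -
  have "disc \<inter> {p} = {}" using assms by auto
  moreover have "0 \<in> disc" by simp
  then have "disc \<noteq> {}" by blast
  ultimately obtain a b where a: "a \<noteq> 0" "\<forall>x\<in>disc. a \<bullet> x \<le> b" "\<forall>x\<in>{p}. b \<le> a \<bullet> x"
    using separating_hyperplane_sets[OF convex_disc convex_singleton[of p]] by auto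
  have le: "a \<bullet> x \<le> (a \<bullet> p) * N x" if "x \<noteq> 0" for x
  proof -
    have *: "t * (a \<bullet> x) \<le> (a \<bullet> p) * N x" if "0 < t" "t < 1" for t
    proof -
      have "(t / N x) *\<^sub>R x \<in> disc" using that pos[OF \<open>x \<noteq> 0\<close>] by (simp add: scale)
      then have "a \<bullet> ((t / N x) *\<^sub>R x) \<le> a \<bullet> p" using a by force
      then show ?thesis using pos[OF \<open>x \<noteq> 0\<close>] by (simp add: field_simps)
    qed
    show ?thesis
    proof (rule field_le_mult_one_interval)
      fix z :: real assume "0 < z" "z < 1"
      then show "z * (a \<bullet> x) \<le> (a \<bullet> p) * N x" by (rule *)
    qed
  qed
  have "0 < a \<bullet> a" using a(1) by simp
  also have "\<dots> \<le> (a \<bullet> p) * N a" by (rule le[OF a(1)])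
  finally have ap: "0 < a \<bullet> p" using N_nonneg[of a] by (simp add: zero_less_mult_iff)
  show thesis
  proof (rule that[of "(1 / (a \<bullet> p)) *\<^sub>R a"])
    show "(1 / (a \<bullet> p)) *\<^sub>R a \<bullet> p = 1" using ap by simp
    show "(1 / (a \<bullet> p)) *\<^sub>R a \<bullet> x \<le> N x" for x
      using le[of x] ap by (cases "x = 0") (auto simp: field_simps)
  qed
qed

end

text \<open>The norm is the Minkowski gauge. All its properties follow from the equivalence of \<open>N x < s\<close> and
  \<open>x / s \<in> K\<close>, in which openness of \<open>K\<close> gives the strict inequality.\<close>

lemma domain_obtain_norm:
  assumes "bounded_convex_symmetric_domain K"
  obtains N where "plane_norm N" "K = {x. N x < 1}"
proof -
  have op: "open K" and bd: "bounded K" and cv: "convex K" and sym: "K = uminus ` K" and ne: "K \<noteq> {}"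
    using assms by (auto simp: bounded_convex_symmetric_domain_def)
  have mK: "- x \<in> K" if "x \<in> K" for x using that sym by blast
  obtain x0 where x0: "x0 \<in> K" using ne by blast
  have "(1/2) *\<^sub>R x0 + (1/2) *\<^sub>R (- x0) \<in> K"
    using cv x0 mK[OF x0] by (intro convexD) auto
  then have K0: "0 \<in> K" by simp
  have shrink: "c *\<^sub>R x \<in> K" if "x \<in> K" "0 \<le> c" "c \<le> 1" for x c
    using convexD[OF cv that(1) K0, of c "1 - c"] that by simp
  define T where "T x = {t. 0 < t \<and> (1/t) *\<^sub>R x \<in> K}" for x
  define N where "N x = Inf (T x)" for x
  obtain e where e: "0 < e" "ball 0 e \<subseteq> K" using op K0 open_contains_ball by blast
  have T_ne: "T x \<noteq> {}" for x
  proof -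
    define t where "t = 2 * (norm x + 1) / e"
    have "0 < t" using e by (simp add: t_def add_nonneg_pos)
    have "norm x < e * t"
      using e by (simp add: t_def) (use norm_ge_zero[of x] in linarith)
    then have "norm ((1/t) *\<^sub>R x) < e"
      using \<open>0 < t\<close> by (simp add: field_simps)
    then have "(1/t) *\<^sub>R x \<in> K" using e by auto
    then show ?thesis using \<open>0 < t\<close> by (auto simp: T_def)
  qed
  have T_bdd: "bdd_below (T x)" for x by (rule bdd_belowI[of _ 0]) (auto simp: T_def)
  have N0: "0 \<le> N x" for x
    unfolding N_def by (rule cInf_greatest[OF T_ne]) (auto simp: T_def)
  have N_less: "N x < s \<longleftrightarrow> (1/s) *\<^sub>R x \<in> K" if s: "0 < s" for x s
  proof
    assume "N x < s"
    then obtain t where t: "t \<in> T x" "t < s" unfolding N_def using cInf_lessD[OF T_ne] by blast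
    then have "(t/s) *\<^sub>R ((1/t) *\<^sub>R x) \<in> K" using s by (rule_tac shrink) (auto simp: T_def)
    then show "(1/s) *\<^sub>R x \<in> K" using t by (auto simp: T_def)
  next
    assume "(1/s) *\<^sub>R x \<in> K"
    then obtain d where d: "0 < d" "ball ((1/s) *\<^sub>R x) d \<subseteq> K" using op open_contains_ball by blast
    define r where "r = d / (2 * (norm ((1/s) *\<^sub>R x) + 1))"
    have r: "0 < r" using d by (simp add: r_def add_nonneg_pos)
    have "r * norm ((1/s) *\<^sub>R x) < d"
      using d norm_ge_zero[of "(1/s) *\<^sub>R x"]
      unfolding r_def by (simp add: divide_less_eq add_nonneg_pos del: norm_scaleR)
    moreover have "dist y ((1 + r) *\<^sub>R y) = r * norm y" for y :: "real^2"
      using r by (simp add: dist_norm scaleR_add_left)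
    ultimately have "(1 + r) *\<^sub>R ((1/s) *\<^sub>R x) \<in> ball ((1/s) *\<^sub>R x) d"
      unfolding mem_ball by metis
    then have "(1 + r) *\<^sub>R ((1/s) *\<^sub>R x) \<in> K" using d by blast
    then have "s / (1 + r) \<in> T x" using s r by (simp add: T_def)
    then have "N x \<le> s / (1 + r)" unfolding N_def by (rule cInf_lower[OF _ T_bdd])
    also have "\<dots> < s" using s r by (simp add: divide_less_eq)
    finally show "N x < s" .
  qed
  have "plane_norm N"
  proof
    fix x y :: "real^2" and c :: real
    show "N (x + y) \<le> N x + N y"
    proof (rule field_le_epsilon)
      fix \<epsilon> :: real assume "0 < \<epsilon>"
      define s t where "s = N x + \<epsilon>/2" and "t = N y + \<epsilon>/2"
      have st: "0 < s" "0 < t" using N0[of x] N0[of y] \<open>0 < \<epsilon>\<close> by (auto simp: s_def t_def)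
      have "(1/s) *\<^sub>R x \<in> K" "(1/t) *\<^sub>R y \<in> K"
        using N_less[OF st(1), of x] N_less[OF st(2), of y] \<open>0 < \<epsilon>\<close> by (auto simp: s_def t_def)
      then have "(s/(s+t)) *\<^sub>R ((1/s) *\<^sub>R x) + (t/(s+t)) *\<^sub>R ((1/t) *\<^sub>R y) \<in> K"
        using st by (intro convexD[OF cv]) (simp_all add: add_divide_distrib[symmetric])
      then have "(1/(s+t)) *\<^sub>R (x + y) \<in> K" using st by (simp add: scaleR_add_right)
      then have "N (x + y) < s + t" using N_less[of "s+t" "x+y"] st by simp
      then show "N (x + y) \<le> N x + N y + \<epsilon>" by (simp add: s_def t_def)
    qed
    have sc: "N (c *\<^sub>R x) \<le> \<bar>c\<bar> * N x" for c x
    proof (cases "c = 0")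
      case True
      have "N 0 < s" if "0 < s" for s using N_less[OF that, of 0] K0 by simp
      then have "N 0 \<le> 0" by (meson leI less_irrefl)
      then show ?thesis using True by simp
    next
      case False
      show ?thesis
      proof (rule field_le_epsilon)
        fix \<epsilon> :: real assume "0 < \<epsilon>"
        define s where "s = N x + \<epsilon> / \<bar>c\<bar>"
        have s: "0 < s" using N0[of x] \<open>0 < \<epsilon>\<close> False by (auto simp: s_def intro: add_nonneg_pos)
        have "(1/s) *\<^sub>R x \<in> K" using N_less[OF s, of x] \<open>0 < \<epsilon>\<close> False by (auto simp: s_def)
        then have "(1/(\<bar>c\<bar> * s)) *\<^sub>R (c *\<^sub>R x) \<in> K"
          using False mK by (cases "0 < c") fastforce+
        then have "N (c *\<^sub>R x) < \<bar>c\<bar> * s" using N_less[of "\<bar>c\<bar> * s" "c *\<^sub>R x"] s False by simp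
        then show "N (c *\<^sub>R x) \<le> \<bar>c\<bar> * N x + \<epsilon>" using False by (simp add: s_def algebra_simps)
      qed
    qed
    show "N (c *\<^sub>R x) = \<bar>c\<bar> * N x"
    proof (cases "c = 0")
      case True
      then show ?thesis using sc[of 0 x] N0[of 0] by simp
    next
      case False
      have "N ((1/c) *\<^sub>R (c *\<^sub>R x)) \<le> \<bar>1/c\<bar> * N (c *\<^sub>R x)" by (rule sc)
      then have "\<bar>c\<bar> * N x \<le> N (c *\<^sub>R x)" using False by (simp add: field_simps)
      then show ?thesis using sc[of c x] by simp
    qed
    show "0 < N x" if "x \<noteq> 0"
    proof (rule ccontr)
      assume "\<not> 0 < N x"
      then have *: "(1/s) *\<^sub>R x \<in> K" if "0 < s" for s using N_less[OF that, of x] that by simp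
      obtain B where B: "0 < B" "\<And>y. y \<in> K \<Longrightarrow> norm y \<le> B" using bd bounded_pos by metis
      have "norm ((1 / (norm x / (2*B))) *\<^sub>R x) \<le> B" using B that by (intro B(2) *) simp
      then show False using that B(1) by simp
    qed
  qed
  moreover have "K = {x. N x < 1}" using N_less[of 1] by simp
  ultimately show thesis by (rule that)
qed

section \<open>Inscribed hexagons and their lattices\<close>

context plane_norm
begin

text \<open>With \<open>P\<close>, \<open>Q\<close> and \<open>Q - P\<close> the negatives lie on the boundary too. The six points are, in counterclockwise
  order, the vertices of an inscribed affinely regular hexagon.\<close>

definition hex :: "real^2 \<Rightarrow> real^2 \<Rightarrow> bool" where
  "hex P Q \<longleftrightarrow> N P = 1 \<and> N Q = 1 \<and> N (Q - P) = 1 \<and> 0 < wedge P Q"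

lemma hexD: "hex P Q \<Longrightarrow> N P = 1" "hex P Q \<Longrightarrow> N Q = 1" "hex P Q \<Longrightarrow> N (Q - P) = 1"
  "hex P Q \<Longrightarrow> 0 < wedge P Q"
  by (auto simp: hex_def)

lemma hex_rotate: "hex P Q \<Longrightarrow> hex Q (Q - P)"
  by (auto simp: hex_def wedge_simps wedge_commute[of Q P])

text \<open>A convex function on a line that does not decrease over one step does not decrease afterwards.\<close>

lemma N_ray_ge:
  assumes "0 \<le> t" "N (X - P) \<le> N X"
  shows "N X \<le> N (X + t *\<^sub>R P)"
proof -
  have "(1 + t) *\<^sub>R X = t *\<^sub>R (X - P) + 1 *\<^sub>R (X + t *\<^sub>R P)" by (simp add: algebra_simps)
  then have "N ((1 + t) *\<^sub>R X) \<le> t * N (X - P) + 1 * N (X + t *\<^sub>R P)"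
    using N_comb[OF assms(1), of 1] by simp
  also have "\<dots> \<le> t * N X + N (X + t *\<^sub>R P)" using assms by (simp add: mult_left_mono)
  finally have "(1 + t) * N X \<le> t * N X + N (X + t *\<^sub>R P)" using assms(1) by (simp only: scale)
  then show ?thesis by (simp add: distrib_right)
qed

text \<open>Along the line \<open>Q + t P\<close> the norm takes the value \<open>1\<close> at \<open>t = -1\<close> and \<open>t = 0\<close>, so it is at least \<open>1\<close> for all
  \<open>t \<ge> 0\<close>; rescaling gives the bound on \<open>b\<close>, and exchanging the roles of \<open>P\<close> and \<open>Q\<close> the one on \<open>a\<close>.\<close>

lemma hex_coeff_le:
  assumes h: "hex P Q" and ab: "0 \<le> a" "0 \<le> b"
  shows "a \<le> N (a *\<^sub>R P + b *\<^sub>R Q)" "b \<le> N (a *\<^sub>R P + b *\<^sub>R Q)"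
proof -
  have *: "c \<le> N (d *\<^sub>R X + c *\<^sub>R Y)" if "N Y = 1" "N (Y - X) = 1" "0 \<le> c" "0 \<le> d" for c d X Y
  proof (cases "c = 0")
    case False
    then have "N Y \<le> N (Y + (d / c) *\<^sub>R X)" using that by (intro N_ray_ge) auto
    then have "c * N Y \<le> \<bar>c\<bar> * N (Y + (d / c) *\<^sub>R X)" using that(3) by (simp only: abs_of_nonneg mult_left_mono)
    also have "\<dots> = N (c *\<^sub>R (Y + (d / c) *\<^sub>R X))" by (rule scale[symmetric])
    also have "c *\<^sub>R (Y + (d / c) *\<^sub>R X) = d *\<^sub>R X + c *\<^sub>R Y" using False by (simp add: algebra_simps)
    finally show ?thesis using that by simp
  qed (simp add: N_nonneg)
  show "b \<le> N (a *\<^sub>R P + b *\<^sub>R Q)" using *[of Q P b a] h ab by (simp add: hex_def)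
  show "a \<le> N (a *\<^sub>R P + b *\<^sub>R Q)"
    using *[of P Q a b] h ab N_diff_commute[of P Q] by (simp add: hex_def add.commute)
qed

text \<open>The hexagon divides the plane into six sectors spanned by neighbouring vertices. Up to rotation and sign a
  lattice vector has nonnegative integer coordinates in such a pair, and \<open>hex_coeff_le\<close> applies.\<close>

lemma hex_lattice_N_ge:
  assumes h: "hex P Q" and x: "x \<in> lat P Q" "x \<noteq> 0"
  shows "1 \<le> N x"
proof -
  obtain m n :: int where mn: "x = of_int m *\<^sub>R P + of_int n *\<^sub>R Q" using x by (auto simp: lat_def)
  have key: "1 \<le> N (of_int m *\<^sub>R P + of_int n *\<^sub>R Q)" if "0 \<le> n" "m \<noteq> 0 \<or> n \<noteq> 0" for m n :: int
  proof (cases "0 \<le> m")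
    case True
    have "of_int (max m n) \<le> N (of_int m *\<^sub>R P + of_int n *\<^sub>R Q)"
      using hex_coeff_le[OF h, of "of_int m" "of_int n"] that True by (auto simp: max_def)
    moreover have "1 \<le> max m n" using that True by linarith
    ultimately show ?thesis by (smt (verit) of_int_1_le_iff)
  next
    case False
    \<comment> \<open>In the sector between \<open>Q\<close> and \<open>- P\<close> one expands in \<open>Q - P\<close> and one of its neighbours.\<close>
    have h1: "hex Q (Q - P)" by (rule hex_rotate[OF h])
    have h2: "hex (Q - P) (- P)" using hex_rotate[OF h1] by simp
    show ?thesis
    proof (cases "- m \<le> n")
      case True
      have "of_int m *\<^sub>R P + of_int n *\<^sub>R Q = of_int (n + m) *\<^sub>R Q + of_int (- m) *\<^sub>R (Q - P)"
        by (simp add: algebra_simps)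
      then have "of_int (- m) \<le> N (of_int m *\<^sub>R P + of_int n *\<^sub>R Q)"
        using hex_coeff_le(2)[OF h1, of "of_int (n + m)" "of_int (- m)"] True False by simp
      moreover have "1 \<le> - m" using False by linarith
      ultimately show ?thesis by (smt (verit) of_int_1_le_iff)
    next
      case c: False
      have "of_int m *\<^sub>R P + of_int n *\<^sub>R Q = of_int n *\<^sub>R (Q - P) + of_int (- m - n) *\<^sub>R (- P)"
        by (simp add: algebra_simps)
      then have "of_int (- m - n) \<le> N (of_int m *\<^sub>R P + of_int n *\<^sub>R Q)"
        using hex_coeff_le(2)[OF h2, of "of_int n" "of_int (- m - n)"] that c by simp
      moreover have "1 \<le> - m - n" using c by linarith
      ultimately show ?thesis by (smt (verit) of_int_1_le_iff)
    qed
  qed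
  show ?thesis
  proof (cases "0 \<le> n")
    case True
    moreover have "m \<noteq> 0 \<or> n \<noteq> 0" using x(2) mn by auto
    ultimately show ?thesis using key[of n m] mn by simp
  next
    case False
    have "- x = of_int (- m) *\<^sub>R P + of_int (- n) *\<^sub>R Q" by (simp add: mn)
    then show ?thesis using key[of "- n" "- m"] False N_minus[of x] by simp
  qed
qed

lemma hex_admissible:
  assumes "hex P Q"
  shows "admissible disc (lat P Q)"
proof -
  have "is_lattice (lat P Q)" using hexD(4)[OF assms] by (intro is_lattice_lat) simp
  moreover have "lat P Q \<inter> disc = {0}"
    using hex_lattice_N_ge[OF assms] lat_zero[of P Q] by fastforce
  ultimately show ?thesis by (simp add: admissible_def)
qed

text \<open>Among all chords \<open>[X - P, X]\<close> of the closed disc take one that is farthest from the line through \<open>P\<close>. If one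
  end of it were inside the disc, a small shift along \<open>P\<close> would bring both ends inside, and the chord could be moved
  farther away.\<close>

lemma exists_hex:
  assumes P: "N P = 1"
  obtains X where "hex P X"
proof -
  define S where "S = {X. N X \<le> 1} \<inter> {X. N (X - P) \<le> 1}"
  have "closed {X. N (X - P) \<le> 1}"
    by (intro closed_Collect_le continuous_intros)
  then have "compact S" unfolding S_def by (intro compact_Int_closed compact_N_le)
  moreover have "0 \<in> S" using P by (simp add: S_def)
  ultimately obtain X where X: "X \<in> S" "\<And>Y. Y \<in> S \<Longrightarrow> wedge P Y \<le> wedge P X"
    using continuous_attains_sup[of S "wedge P"] continuous_on_wedge[OF continuous_on_const continuous_on_id, of S P]
    by (metis empty_iff eq_id_iff)
  have P0: "P \<noteq> 0" using P by auto
  have Y0: "\<exists>Y. 0 < wedge P Y \<and> N Y < 1 \<and> N (Y - P) < 1"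
  proof -
    \<comment> \<open>Some chord has positive height: move \<open>P/2\<close>, where both norms are \<open>1/2\<close>, slightly off the line.\<close>
    obtain C where C: "wedge P C \<noteq> 0"
    proof -
      have "wedge P (vector [- (P $ 2), P $ 1]) \<noteq> 0"
        using P0 by (auto simp: wedge_def vec_eq_iff forall_2)
      then show thesis by (rule that)
    qed
    define D where "D = (if 0 < wedge P C then C else - C)"
    have D: "0 < wedge P D" using C by (auto simp: D_def wedge_simps)
    then have "D \<noteq> 0" by (auto simp: wedge_simps)
    then have ND: "0 < N D" by (rule pos)
    define r where "r = 1 / (4 * N D)"
    define Y where "Y = (1/2) *\<^sub>R P + r *\<^sub>R D"
    have r: "0 < r" using ND by (simp add: r_def)
    have "N Y \<le> 1/2 * N P + r * N D" unfolding Y_def using r by (intro N_comb) auto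
    then have 1: "N Y < 1" using P ND by (simp add: r_def)
    have "Y - P = (1/2) *\<^sub>R (- P) + r *\<^sub>R D" by (simp add: Y_def algebra_simps flip: scaleR_add_left)
    then have "N (Y - P) \<le> 1/2 * N (- P) + r * N D" using r by (metis N_comb less_imp_le zero_less_divide_1_iff zero_less_numeral)
    then have 2: "N (Y - P) < 1" using P ND by (simp add: r_def)
    have "0 < wedge P Y" using D r by (simp add: Y_def wedge_simps)
    then show ?thesis using 1 2 by blast
  qed
  have pos_w: "0 < wedge P X"
  proof -
    obtain Y where "0 < wedge P Y" "N Y < 1" "N (Y - P) < 1" using Y0 by blast
    then show ?thesis using X(2)[of Y] by (simp add: S_def)
  qed
  \<comment> \<open>A chord inside the disc can be raised by scaling \<open>Z\<close> with a factor \<open>1 + s\<close>; \<open>s\<close> is chosen to fit the slack.\<close>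
  have no: False if Z: "N Z < 1" "N (Z - P) < 1" "wedge P Z = wedge P X" for Z
  proof -
    define c where "c = max (N Z) (N (Z - P))"
    define s where "s = (1 - c) / (2 * (N Z + 1))"
    have c: "c < 1" using Z by (simp add: c_def)
    have s: "0 < s" unfolding s_def
    by (intro divide_pos_pos) (use c N_nonneg[of Z] in argo)+
    have sN: "s * N Z < 1 - c"
    proof -
      have "s * N Z \<le> s * (N Z + 1)" using s by simp
      also have "\<dots> = (1 - c) / 2" 
        using add_nonneg_pos[OF N_nonneg[of Z], of 1] by (simp add: s_def field_simps)
      also have "\<dots> < 1 - c" using c by simp
      finally show ?thesis .
    qed
    have "N (Z + s *\<^sub>R Z) \<le> N Z + s * N Z" using triangle[of Z "s *\<^sub>R Z"] s by (simp add: scale)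
    moreover have "N ((Z - P) + s *\<^sub>R Z) \<le> N (Z - P) + s * N Z"
      using triangle[of "Z - P" "s *\<^sub>R Z"] s by (simp add: scale)
    moreover have "N Z \<le> c" "N (Z - P) \<le> c" by (auto simp: c_def)
    ultimately have "Z + s *\<^sub>R Z \<in> S" using sN by (simp add: S_def algebra_simps)
    from X(2)[OF this] show False using Z(3) mult_pos_pos[OF s pos_w] by (simp add: wedge_simps)
  qed
  have XS: "N X \<le> 1" "N (X - P) \<le> 1" using X(1) by (auto simp: S_def)
  \<comment> \<open>If only the end \<open>W\<close> is inside, sliding the chord towards \<open>W\<close> brings both ends inside.\<close>
  have shift: "\<exists>t. 0 < t \<and> t < 1 \<and> N (V - t *\<^sub>R U) < 1 \<and> N (W - t *\<^sub>R U) < 1"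
    if "N W < 1" "N V \<le> 1" "V - U = W" for U V W
  proof -
    define t where "t = (1 - N W) / (2 * (N U + 1))"
    have t: "0 < t" unfolding t_def
      by (intro divide_pos_pos) (use that N_nonneg[of U] in argo)+
    have "t \<le> (1 - N W) / 2"
      unfolding t_def using that N_nonneg[of U] by (intro divide_left_mono) (auto simp: add_nonneg_pos)
    then have t1: "t < 1" using N_nonneg[of W] by argo
    have "V - t *\<^sub>R U = (1 - t) *\<^sub>R V + t *\<^sub>R W" using that(3) by (auto simp: algebra_simps)
    then have "N (V - t *\<^sub>R U) \<le> (1 - t) * N V + t * N W"
      using t t1 by (metis N_comb diff_ge_0_iff_ge less_imp_le)
    also have "\<dots> < 1"
    proof -
      have "(1 - t) * N V \<le> (1 - t) * 1" using t1 that by (intro mult_left_mono) auto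
      moreover have "t * N W < t * 1" using t that by (intro mult_strict_left_mono) auto
      ultimately show ?thesis by simp
    qed
    finally have a: "N (V - t *\<^sub>R U) < 1" .
    have "t * N U \<le> t * (N U + 1)" using t by simp
    also have "\<dots> = (1 - N W) / 2" using add_nonneg_pos[OF N_nonneg[of U], of 1] by (simp add: t_def field_simps)
    finally have "t * N U < 1 - N W" using that by simp
    moreover have "N (W - t *\<^sub>R U) \<le> N W + t * N U" using N_diff_le[of W "t *\<^sub>R U"] t by (simp add: scale)
    ultimately have "N (W - t *\<^sub>R U) < 1" by simp
    then show ?thesis using a t t1 by blast
  qed
  have "N (X - P) = 1"
  proof (rule ccontr)
    assume "N (X - P) \<noteq> 1"
    then obtain t where t: "N (X - t *\<^sub>R P) < 1" "N (X - P - t *\<^sub>R P) < 1"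
      using shift[of "X - P" X P] XS by auto
    show False using t no[of "X - t *\<^sub>R P"] by (simp add: wedge_simps algebra_simps)
  qed
  moreover have "N X = 1"
  proof (rule ccontr)
    assume "N X \<noteq> 1"
    then obtain t where t: "N (X - P - t *\<^sub>R (- P)) < 1" "N (X - t *\<^sub>R (- P)) < 1"
      using shift[of X "X - P" "- P"] XS by auto
    show False using t no[of "X + t *\<^sub>R P"] by (simp add: wedge_simps algebra_simps)
  qed
  ultimately show thesis using that P pos_w by (simp add: hex_def)
qed

end

section \<open>Reduction of admissible lattices\<close>

text \<open>By Cramer's rule the coordinates of a lattice vector are quotients of determinants, hence bounded on \<open>S\<close>.\<close>

lemma finite_lattice_bounded:
  assumes w: "wedge A B \<noteq> 0" and bd: "bounded S"
  shows "finite (lat A B \<inter> S)"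
proof -
  obtain r where r: "\<And>x. x \<in> S \<Longrightarrow> norm x \<le> r" using bd bounded_iff by metis
  have le: "\<bar>wedge x y\<bar> \<le> 2 * norm x * norm y" for x y
  proof -
    have "\<bar>wedge x y\<bar> \<le> \<bar>x $ 1\<bar> * \<bar>y $ 2\<bar> + \<bar>x $ 2\<bar> * \<bar>y $ 1\<bar>"
      unfolding wedge_def abs_mult[symmetric] by (rule abs_triangle_ineq4)
    also have "\<dots> \<le> norm x * norm y + norm x * norm y"
      by (intro add_mono mult_mono component_le_norm_cart) auto
    finally show ?thesis by simp
  qed
  define k :: int where "k = \<lceil>2 * r * max (norm A) (norm B) / \<bar>wedge A B\<bar>\<rceil>"
  have bound: "\<bar>m\<bar> \<le> k"
    if "of_int m = wedge x y / wedge A B" "norm x \<le> r" "norm y \<le> max (norm A) (norm B)" for m x y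
  proof -
    have "0 \<le> r" using that(2) norm_ge_zero[of x] by linarith
    have "\<bar>wedge x y\<bar> \<le> 2 * norm x * norm y" by (rule le)
    also have "\<dots> \<le> 2 * r * max (norm A) (norm B)"
      using that \<open>0 \<le> r\<close> by (intro mult_mono) auto
    finally have "of_int \<bar>m\<bar> \<le> 2 * r * max (norm A) (norm B) / \<bar>wedge A B\<bar>"
      using w by (simp add: that(1) divide_right_mono)
    then show ?thesis unfolding k_def by linarith
  qed
  have "lat A B \<inter> S \<subseteq> (\<lambda>(m, n). of_int m *\<^sub>R A + of_int n *\<^sub>R B) ` ({-k..k} \<times> {-k..k})"
  proof
    fix x assume x: "x \<in> lat A B \<inter> S"
    then obtain m n :: int where mn: "x = of_int m *\<^sub>R A + of_int n *\<^sub>R B" by (auto simp: lat_def)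
    have "\<bar>m\<bar> \<le> k" "\<bar>n\<bar> \<le> k"
      using x r w by (auto intro!: bound[of m x B] bound[of n x "- A"] simp: mn wedge_simps wedge_commute[of B A])
    then show "x \<in> (\<lambda>(m, n). of_int m *\<^sub>R A + of_int n *\<^sub>R B) ` ({-k..k} \<times> {-k..k})"
      unfolding mn by (intro rev_image_eqI[of "(m, n)"]) auto
  qed
  then show ?thesis by (rule finite_subset) auto
qed

context plane_norm
begin

text \<open>A shortest vector has coprime coordinates, since otherwise a proper fraction of it would be a shorter lattice
  vector. Bezout coefficients of the coordinates complete it to a basis.\<close>

lemma shortest_vector_basis:
  assumes "is_lattice \<Lambda>"
  obtains P Q where "\<Lambda> = lat P Q" "0 < wedge P Q" "\<And>y. y \<in> \<Lambda> \<Longrightarrow> y \<noteq> 0 \<Longrightarrow> N P \<le> N y"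
proof -
  obtain A B where AB: "\<Lambda> = lat A B" "wedge A B \<noteq> 0" using assms by (rule is_lattice_obtain_lat)
  define S where "S = (lat A B \<inter> {x. N x \<le> N A}) - {0}"
  have "finite S" unfolding S_def using finite_lattice_bounded[OF AB(2) bounded_N_le] by blast
  moreover have "A \<in> S" using lat_basis_mem(1)[of A B] AB(2) by (auto simp: S_def wedge_simps)
  ultimately have "\<exists>P\<in>S. \<forall>y\<in>S. N P \<le> N y"
    by (metis arg_min_if_finite(1) arg_min_least empty_iff)
  then obtain P where P: "P \<in> S" and Pmin: "\<And>y. y \<in> S \<Longrightarrow> N P \<le> N y" by blast
  have min: "N P \<le> N y" if "y \<in> lat A B" "y \<noteq> 0" for y
    using that Pmin[of y] P by (cases "N y \<le> N A") (auto simp: S_def)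
  obtain m n :: int where mn: "P = of_int m *\<^sub>R A + of_int n *\<^sub>R B" using P by (auto simp: S_def lat_def)
  have P0: "P \<noteq> 0" using P by (simp add: S_def)
  define g where "g = gcd m n"
  have "g = 1"
  proof (rule ccontr)
    assume "g \<noteq> 1"
    moreover have "g \<noteq> 0" using P0 mn by (auto simp: g_def)
    moreover have "0 \<le> g" by (simp add: g_def)
    ultimately have g2: "2 \<le> g" by linarith
    obtain m' n' where m': "m = g * m'" "n = g * n'"
      using gcd_dvd1[of m n] gcd_dvd2[of m n] unfolding g_def dvd_def by blast
    define P' where "P' = of_int m' *\<^sub>R A + of_int n' *\<^sub>R B"
    have eq: "P = of_int g *\<^sub>R P'" by (simp add: mn P'_def m' algebra_simps)
    then have "P' \<noteq> 0" using P0 by auto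
    then have "N P \<le> N P'" using min lat_memI by (auto simp: P'_def)
    moreover have "N P = of_int g * N P'" using g2 by (simp add: eq scale)
    moreover have "0 < N P'" by (rule pos) fact
    moreover have "1 * N P' < of_int g * N P'" using g2 \<open>0 < N P'\<close> by (intro mult_strict_right_mono) auto
    ultimately show False by simp
  qed
  then obtain u v where uv: "u * m + v * n = 1" using bezout_int[of m n] by (auto simp: g_def)
  define Q where "Q = of_int (- v) *\<^sub>R A + of_int u *\<^sub>R B"
  have uv': "of_int u * of_int m + of_int v * of_int n = (1::real)"
    using arg_cong[OF uv, of real_of_int] by simp
  have "wedge P Q = (of_int u * of_int m + of_int v * of_int n) * wedge A B"
    by (simp add: mn Q_def wedge_simps wedge_commute[of B A] algebra_simps)
  then have w: "wedge P Q = wedge A B" using uv' by simp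
  have L: "lat P Q = \<Lambda>"
    unfolding AB(1)
  proof (rule lat_eq_if_wedge_eq)
    show "P \<in> lat A B" "Q \<in> lat A B" unfolding mn Q_def by (rule lat_memI)+
  qed (use w AB in auto)
  show thesis
  proof (cases "0 < wedge P Q")
    case True
    then show ?thesis using that[of P Q] L min AB by auto
  next
    case False
    then have neg: "0 < wedge P (- Q)" using w AB(2) by (simp add: wedge_simps)
    have "lat P (- Q) = lat P Q"
      using neg by (intro lat_eq_if_wedge_eq lat_basis_mem lat_minus) (auto simp: wedge_simps)
    then show ?thesis using that[of P "- Q"] L min neg AB by auto
  qed
qed

text \<open>If \<open>Q\<close> were closer to the line through \<open>P\<close> than the chord of the hexagon, scaled by \<open>N P\<close>, then by convexity
  the line through \<open>Q\<close> parallel to \<open>P\<close> would meet the open disc of radius \<open>N P\<close> in a segment longer than \<open>P\<close>. That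
  segment contains some \<open>Q + k P\<close>, against minimality.\<close>

lemma chord_lattice_point:
  assumes P: "0 < N P" and PQ: "0 < wedge P Q" and min: "\<And>k::int. N P \<le> N (Q + of_int k *\<^sub>R P)"
    and h: "hex ((1 / N P) *\<^sub>R P) X"
  shows "N P * wedge P X \<le> wedge P Q"
proof (rule ccontr)
  define m where "m = N P"
  define U where "U = (1 / m) *\<^sub>R P"
  have m: "0 < m" using P by (simp add: m_def)
  have PU: "P = m *\<^sub>R U" using m by (simp add: U_def)
  have hU: "hex U X" using h by (simp add: U_def m_def)
  assume "\<not> ?thesis"
  then have less: "wedge P Q < m * wedge P X" by (simp add: m_def)
  have "0 < wedge P X" using hexD(4)[OF hU] m by (simp add: PU wedge_simps)
  define y where "y = wedge P Q / (m * wedge P X)"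
  \<comment> \<open>The line of \<open>Q\<close> passes through \<open>m y X\<close>; on it the open disc of radius \<open>m\<close> contains \<open>m (y X + v U)\<close> for\<close>
  \<comment> \<open>\<open>- y \<le> v < 1 - y\<close>, which is a full period.\<close>
  have "wedge P (Q - (m * y) *\<^sub>R X) = 0"
    using m \<open>0 < wedge P X\<close> by (simp add: y_def wedge_simps)
  then obtain c where c: "Q - (m * y) *\<^sub>R X = c *\<^sub>R P"
    using wedge_eq_0_imp_scale[of P] P by (metis N_zero less_irrefl)
  have y1: "y < 1" using less m \<open>0 < wedge P X\<close> by (simp add: y_def)
  have y0: "0 \<le> y" using PQ m \<open>0 < wedge P X\<close> by (simp add: y_def)
    define k where "k = - \<lfloor>c + y\<rfloor>"
    define v where "v = c + of_int k"
    have v: "- y \<le> v" "v < 1 - y" unfolding v_def k_def by linarith+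
    have NX: "N (y *\<^sub>R X + v *\<^sub>R U) < 1"
    proof (cases "v < 0")
      case True
      have "y *\<^sub>R X + v *\<^sub>R U = (y + v) *\<^sub>R X + (- v) *\<^sub>R (X - U)" by (simp add: algebra_simps)
      then have "N (y *\<^sub>R X + v *\<^sub>R U) \<le> (y + v) * N X + (- v) * N (X - U)"
        using v True by (metis N_comb add.commute diff_ge_0_iff_ge diff_minus_eq_add less_imp_le neg_0_le_iff_le)
      then show ?thesis using hU y1 by (simp add: hex_def)
    next
      case False
      have "N (y *\<^sub>R X + v *\<^sub>R U) \<le> y * N X + v * N U"
        using y0 False by (intro N_comb) auto
      then show ?thesis using hU v by (simp add: hex_def)
    qed
    have "Q + of_int k *\<^sub>R P = m *\<^sub>R (y *\<^sub>R X + v *\<^sub>R U)"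
      using c m by (simp add: v_def U_def algebra_simps)
    then have "N (Q + of_int k *\<^sub>R P) = m * N (y *\<^sub>R X + v *\<^sub>R U)" using m by (simp add: scale)
    also have "\<dots> < m * 1" using NX m by (rule mult_strict_left_mono)
    finally show False using min[of k] by (simp add: m_def)
qed

text \<open>Scaling the shortest vector \<open>P\<close> to the boundary costs a factor \<open>N P\<close> in each of the two directions. The square is
  kept because for a critical lattice it forces \<open>N P = 1\<close>.\<close>

lemma admissible_reduction:
  assumes "admissible disc \<Lambda>"
  obtains P Q X where "\<Lambda> = lat P Q" "0 < wedge P Q" "1 \<le> N P"
    "\<And>k::int. N P \<le> N (Q + of_int k *\<^sub>R P)"
    "hex ((1 / N P) *\<^sub>R P) X" "(N P)\<^sup>2 * wedge ((1 / N P) *\<^sub>R P) X \<le> wedge P Q"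
proof -
  have lat: "is_lattice \<Lambda>" and adm: "\<And>y. y \<in> \<Lambda> \<Longrightarrow> y \<noteq> 0 \<Longrightarrow> 1 \<le> N y"
    using assms by (force simp: admissible_def)+
  obtain P Q where PQ: "\<Lambda> = lat P Q" "0 < wedge P Q" "\<And>y. y \<in> \<Lambda> \<Longrightarrow> y \<noteq> 0 \<Longrightarrow> N P \<le> N y"
    using shortest_vector_basis[OF lat] by blast
  have "P \<noteq> 0" using PQ(2) by (auto simp: wedge_simps)
  then have NP: "1 \<le> N P" using adm PQ(1) lat_basis_mem by blast
  define U where "U = (1 / N P) *\<^sub>R P"
  have "N U = 1" using NP by (simp add: U_def scale)
  then obtain X where X: "hex U X" by (rule exists_hex)
  have min: "N P \<le> N (Q + of_int k *\<^sub>R P)" for k :: int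
  proof (rule PQ(3))
    show "Q + of_int k *\<^sub>R P \<in> \<Lambda>" unfolding PQ(1) by (intro lat_add lat_scale lat_basis_mem)
    show "Q + of_int k *\<^sub>R P \<noteq> 0"
    proof
      assume "Q + of_int k *\<^sub>R P = 0"
      then have "wedge P (Q + of_int k *\<^sub>R P) = 0" by (simp add: wedge_simps)
      then show False using PQ(2) by (simp add: wedge_simps)
    qed
  qed
  have "N P * wedge P X \<le> wedge P Q"
    using chord_lattice_point[of P Q X] NP PQ(2) X min by (simp add: U_def)
  moreover have "wedge P X = N P * wedge U X" using NP by (simp add: U_def wedge_simps)
  ultimately have "(N P)\<^sup>2 * wedge U X \<le> wedge P Q" by (simp add: power2_eq_square)
  then show thesis using that[OF PQ(1,2) NP min] X by (simp add: U_def)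
qed

lemma admissible_obtain_hex:
  assumes "admissible disc \<Lambda>"
  obtains P X where "hex P X" "wedge P X \<le> covolume \<Lambda>"
proof -
  obtain P Q X where PQ: "\<Lambda> = lat P Q" "0 < wedge P Q" "1 \<le> N P"
    and X: "hex ((1 / N P) *\<^sub>R P) X" and le: "(N P)\<^sup>2 * wedge ((1 / N P) *\<^sub>R P) X \<le> wedge P Q"
    using admissible_reduction[OF assms] by metis
  have "1 * wedge ((1 / N P) *\<^sub>R P) X \<le> (N P)\<^sup>2 * wedge ((1 / N P) *\<^sub>R P) X"
    using PQ(3) hexD(4)[OF X] one_le_power[OF PQ(3), of 2] by (intro mult_right_mono) auto
  moreover have "covolume \<Lambda> = wedge P Q" using PQ by (simp add: covolume_lat)
  ultimately show thesis using that[OF X] le by simp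
qed

lemma critical_determinant_le_hex:
  assumes "hex P X"
  shows "critical_determinant disc \<le> wedge P X"
  unfolding critical_determinant_def
proof (rule cInf_lower)
  show "wedge P X \<in> {covolume \<Lambda> |\<Lambda>. admissible disc \<Lambda>}"
    using hex_admissible[OF assms] covolume_lat[of P X] hexD(4)[OF assms] by force
  have "0 \<le> covolume \<Lambda>" if adm: "admissible disc \<Lambda>" for \<Lambda>
  proof -
    obtain P X where "hex P X" "wedge P X \<le> covolume \<Lambda>" using admissible_obtain_hex[OF adm] by blast
    then show ?thesis using hexD(4)[of P X] by linarith
  qed
  then show "bdd_below {covolume \<Lambda> |\<Lambda>. admissible disc \<Lambda>}" by (auto intro!: bdd_belowI[of _ 0])
qed

lemma exists_boundary_point: obtains p where "N p = 1"
proof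
  let ?e = "axis 1 1 :: real^2"
  have "0 < N ?e" by (rule pos) (simp add: axis_eq_0_iff)
  then show "N ((1 / N ?e) *\<^sub>R ?e) = 1" by (simp add: scale)
qed

lemma hex_less_of_critical_determinant_less:
  assumes "critical_determinant disc < d"
  obtains P X where "hex P X" "wedge P X < d"
proof -
  obtain p where "N p = 1" by (rule exists_boundary_point)
  then obtain X where "hex p X" by (rule exists_hex)
  then have "{covolume \<Lambda> |\<Lambda>. admissible disc \<Lambda>} \<noteq> {}" using hex_admissible by blast
  from cInf_lessD[OF this assms[unfolded critical_determinant_def]]
  obtain \<Lambda> where "admissible disc \<Lambda>" "covolume \<Lambda> < d" by blast
  then obtain P X where "hex P X" "wedge P X \<le> covolume \<Lambda>" using admissible_obtain_hex by blast
  then show thesis using \<open>covolume \<Lambda> < d\<close> by (intro that[of P X]) auto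
qed

end

section \<open>Irreducibility at extreme points\<close>

text \<open>Intersecting the disc with a symmetric strip yields the disc of another norm, so that everything proved for a
  norm applies to the smaller domain.\<close>

lemma plane_norm_cut:
  assumes "plane_norm N" "0 < b"
  shows "plane_norm (\<lambda>x. max (N x) (\<bar>a \<bullet> x\<bar> / b))"
proof -
  interpret plane_norm N by fact
  show ?thesis
  proof
    fix x y :: "real^2" and c :: real
    have "\<bar>a \<bullet> (x + y)\<bar> / b \<le> \<bar>a \<bullet> x\<bar> / b + \<bar>a \<bullet> y\<bar> / b"
      using assms(2) by (simp add: inner_add_right divide_right_mono flip: add_divide_distrib)
    then show "max (N (x + y)) (\<bar>a \<bullet> (x + y)\<bar> / b) \<le> max (N x) (\<bar>a \<bullet> x\<bar> / b) + max (N y) (\<bar>a \<bullet> y\<bar> / b)"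
      using triangle[of x y] by linarith
    show "max (N (c *\<^sub>R x)) (\<bar>a \<bullet> c *\<^sub>R x\<bar> / b) = \<bar>c\<bar> * max (N x) (\<bar>a \<bullet> x\<bar> / b)"
      by (simp add: scale abs_mult max_mult_distrib_left)
    show "0 < max (N x) (\<bar>a \<bullet> x\<bar> / b)" if "x \<noteq> 0"
      using pos[OF that] by simp
  qed
qed

context plane_norm
begin

lemma extreme_point_N_eq_1:
  assumes e: "e extreme_point_of {x. N x \<le> 1}"
  shows "N e = 1"
proof (rule ccontr)
  assume "N e \<noteq> 1"
  then have lt: "N e < 1" using e by (simp add: extreme_point_of_def)
  define u where "u = (axis 1 1 :: real^2)"
  have u: "u \<noteq> 0" by (simp add: u_def axis_eq_0_iff)
  then have Nu: "0 < N u" by (rule pos)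
  define d where "d = (1 - N e) / N u"
  have d: "0 < d" "d * N u = 1 - N e" using lt Nu by (auto simp: d_def)
  have "N (e + d *\<^sub>R u) \<le> 1" "N (e - d *\<^sub>R u) \<le> 1"
    using triangle[of e "d *\<^sub>R u"] N_diff_le[of e "d *\<^sub>R u"] d by (auto simp: scale)
  moreover have "e = midpoint (e - d *\<^sub>R u) (e + d *\<^sub>R u)" by (simp add: midpoint_def flip: scaleR_2)
  moreover have "e - d *\<^sub>R u \<noteq> e + d *\<^sub>R u"
  proof
    assume eq: "e - d *\<^sub>R u = e + d *\<^sub>R u"
    have "(2 * d) *\<^sub>R u = (e + d *\<^sub>R u) - (e - d *\<^sub>R u)" by (simp add: algebra_simps flip: scaleR_2)
    then have "(2 * d) *\<^sub>R u = 0" using eq by simp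
    then show False using d u by simp
  qed
  ultimately show False
    using e midpoint_in_open_segment[of "e - d *\<^sub>R u" "e + d *\<^sub>R u"] unfolding extreme_point_of_def by auto
qed

lemma exists_extreme_point: obtains e where "e extreme_point_of {x. N x \<le> 1}"
proof -
  have "{x. N x \<le> 1} = convex hull {x. x extreme_point_of {x. N x \<le> 1}}"
    by (rule Krein_Milman_Minkowski[OF compact_N_le convex_N_le])
  moreover have "0 \<in> {x. N x \<le> 1}" by simp
  ultimately have "{x. x extreme_point_of {x. N x \<le> 1}} \<noteq> {}" by (metis convex_hull_empty empty_iff)
  then show thesis using that by blast
qed

text \<open>An extreme point is not in the convex hull of the closed disc with a ball around the point removed, since
  removing an extreme point leaves a convex set. A line separating the two cuts off a cap inside the ball.\<close>

lemma extreme_point_cap: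
  assumes e: "e extreme_point_of {x. N x \<le> 1}" and \<epsilon>: "0 < \<epsilon>"
  obtains a b where "0 < b" "b < a \<bullet> e" "\<And>x. N x \<le> 1 \<Longrightarrow> b \<le> a \<bullet> x \<Longrightarrow> dist e x < \<epsilon>"
proof -
  let ?B = "{x. N x \<le> 1}"
  have "N e = 1" by (rule extreme_point_N_eq_1[OF e])
  then have e0: "e \<noteq> 0" by auto
  define \<delta> where "\<delta> = min \<epsilon> (norm e)"
  have \<delta>: "0 < \<delta>" using \<epsilon> e0 by (simp add: \<delta>_def)
  define S where "S = convex hull (?B - ball e \<delta>)"
  have "compact S" unfolding S_def
    by (intro compact_convex_hull compact_diff compact_N_le open_ball)
  then have "closed S" by (rule compact_imp_closed)
  have cv: "convex (?B - {e})"
    using e extreme_point_of_stillconvex[OF convex_N_le] by blast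
  have "S \<subseteq> ?B - {e}" unfolding S_def
    by (rule hull_minimal) (use \<delta> cv in auto)
  then have "e \<notin> S" by blast
  then obtain a b where ab: "a \<bullet> e < b" "\<And>x. x \<in> S \<Longrightarrow> b < a \<bullet> x"
    using separating_hyperplane_closed_point[of S e] \<open>closed S\<close> by (auto simp: S_def)
  have "0 \<in> ?B - ball e \<delta>" by (simp add: \<delta>_def)
  then have "0 \<in> S" unfolding S_def by (rule hull_inc)
  then have "b < 0" using ab(2)[of 0] by simp
  show thesis
  proof (rule that[of "- b" "- a"])
    fix x assume x: "N x \<le> 1" "- b \<le> - a \<bullet> x"
    then have "x \<notin> S" using ab(2)[of x] by auto
    then have "x \<in> ball e \<delta>" using x(1) hull_inc[of x "?B - ball e \<delta>" convex] by (auto simp: S_def)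
    then show "dist e x < \<epsilon>" by (simp add: \<delta>_def)
  qed (use \<open>b < 0\<close> ab in auto)
qed

end

locale irreducible_norm = plane_norm +
  assumes irreducible: "irreducible_domain {x. N x < 1}"
begin

abbreviation D :: real where "D \<equiv> critical_determinant disc"

text \<open>Hexagons inscribed up to an error \<open>r\<close>, of determinant at most \<open>D\<close>: the approximations from which critical hexagons
  are obtained in the limit.\<close>

definition near :: "real \<Rightarrow> real^2 \<Rightarrow> real^2 \<Rightarrow> bool" where
  "near r P Q \<longleftrightarrow> \<bar>N P - 1\<bar> \<le> r \<and> \<bar>N Q - 1\<bar> \<le> r \<and> \<bar>N (Q - P) - 1\<bar> \<le> r \<and> 0 < wedge P Q \<and> wedge P Q \<le> D"

lemma near_rotate: "near r P Q \<Longrightarrow> near r Q (Q - P)"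
  by (auto simp: near_def wedge_simps wedge_commute[of Q P])

lemma near_minus: "near r P Q \<Longrightarrow> near r (- P) (- Q)"
  using N_minus[of "Q - P"] by (auto simp: near_def wedge_simps N_diff_commute)

text \<open>Cutting off a small cap at \<open>e\<close> and the opposite one lowers the critical determinant, so the smaller domain has an
  inscribed hexagon of determinant below \<open>D\<close>. It cannot be inscribed in the original disc; hence one of its vertices
  was created by the cut and is close to \<open>e\<close> or \<open>- e\<close>. Rotating the hexagon makes this vertex the first one.\<close>

lemma cut_near_extreme_point:
  assumes e: "e extreme_point_of {x. N x \<le> 1}" and \<epsilon>: "0 < \<epsilon>"
    and C: "\<And>x. N x \<le> C * norm x" "0 < C"
  shows "\<exists>P Q. dist e P < \<epsilon> \<and> near (C * \<epsilon>) P Q"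
proof -
  have Ne: "N e = 1" by (rule extreme_point_N_eq_1[OF e])
  obtain a b where b: "0 < b" "b < a \<bullet> e" and cap: "\<And>x. N x \<le> 1 \<Longrightarrow> b \<le> a \<bullet> x \<Longrightarrow> dist e x < \<epsilon>"
    using extreme_point_cap[OF e \<epsilon>] by blast
  define M where "M x = max (N x) (\<bar>a \<bullet> x\<bar> / b)" for x
  have "plane_norm M" unfolding M_def using plane_norm_cut[OF plane_norm_axioms b(1)] .
  then interpret M: plane_norm M .
  have "M.disc \<subset> disc"
  proof
    show "M.disc \<subseteq> disc" by (auto simp: M_def)
    define t where "t = b / (a \<bullet> e)"
    have t: "0 < t" "t < 1" using b by (auto simp: t_def)
    have "t *\<^sub>R e \<in> disc" using t Ne by (simp add: scale)
    moreover have "a \<bullet> (t *\<^sub>R e) = b" using b by (simp add: t_def)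
    then have "t *\<^sub>R e \<notin> M.disc" using b(1) by (simp add: M_def)
    ultimately show "M.disc \<noteq> disc" by blast
  qed
  then have "critical_determinant M.disc < D"
    using irreducible M.disc_domain by (auto simp: irreducible_domain_def)
  then obtain P Q where PQ: "M.hex P Q" "wedge P Q < D"
    using M.hex_less_of_critical_determinant_less by blast
  have close: "N X = 1 \<or> dist e X < \<epsilon> \<or> dist e (- X) < \<epsilon>" if "M X = 1" for X
  proof (cases "N X = 1")
    case False
    then have "N X < 1" "\<bar>a \<bullet> X\<bar> = b" using that b by (auto simp: M_def max_def field_simps split: if_splits)
    then show ?thesis using cap[of X] cap[of "- X"] by (auto simp: abs_if split: if_splits)
  qed simp
  have lip: "\<bar>N X - 1\<bar> \<le> C * \<epsilon>" if "dist e X < \<epsilon>" for X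
  proof -
    have "\<bar>N X - N e\<bar> \<le> C * norm (X - e)" using N_diff_ge[of X e] C(1)[of "X - e"] by linarith
    also have "\<dots> \<le> C * \<epsilon>" using that C(2) by (simp add: dist_norm norm_minus_commute)
    finally show ?thesis using Ne by simp
  qed
  have near1: "\<bar>N X - 1\<bar> \<le> C * \<epsilon>" if "M X = 1" for X
    using close[OF that] lip[of X] lip[of "- X"] C(2) \<epsilon> by auto
  have M1: "M P = 1" "M Q = 1" "M (Q - P) = 1" using PQ(1) by (auto simp: M.hex_def)
  have nr: "near (C * \<epsilon>) P Q"
    using PQ near1 M1 by (auto simp: near_def M.hex_def)
  have "\<not> (N P = 1 \<and> N Q = 1 \<and> N (Q - P) = 1)"
    using critical_determinant_le_hex[of P Q] PQ by (auto simp: hex_def M.hex_def)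
  then have "(dist e P < \<epsilon> \<or> dist e (- P) < \<epsilon>) \<or> (dist e Q < \<epsilon> \<or> dist e (- Q) < \<epsilon>) \<or>
     (dist e (Q - P) < \<epsilon> \<or> dist e (- (Q - P)) < \<epsilon>)"
    using close M1 by metis
  then show ?thesis
    using nr near_minus[OF nr] near_rotate[OF nr] near_minus[OF near_rotate[OF nr]]
      near_rotate[OF near_rotate[OF nr]] near_minus[OF near_rotate[OF near_rotate[OF nr]]] by blast
qed

text \<open>Let the size of the cap tend to \<open>0\<close>. The limit hexagon does not degenerate, as \<open>c\<close> and \<open>c - 1\<close> cannot both have
  absolute value \<open>1\<close>.\<close>

lemma extreme_point_hex:
  assumes e: "e extreme_point_of {x. N x \<le> 1}"
  obtains Q where "hex e Q" "wedge e Q = D"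
proof -
  have Ne: "N e = 1" by (rule extreme_point_N_eq_1[OF e])
  obtain C where C: "0 < C" "\<And>x. N x \<le> C * norm x" using N_le_norm by blast
  define \<epsilon> where "\<epsilon> n = 1 / real (Suc n)" for n
  have "0 < \<epsilon> n" for n by (simp add: \<epsilon>_def)
  then have "\<forall>n. \<exists>P Q. dist e P < \<epsilon> n \<and> near (C * \<epsilon> n) P Q"
    using cut_near_extreme_point[OF e _ C(2,1)] by blast
  then obtain P Q where PQ: "\<And>n. dist e (P n) < \<epsilon> n" "\<And>n. near (C * \<epsilon> n) (P n) (Q n)" by metis
  have \<epsilon>0: "\<epsilon> \<longlonglongrightarrow> 0" unfolding \<epsilon>_def by (rule LIMSEQ_Suc[OF lim_1_over_n])
  then have C\<epsilon>: "(\<lambda>n. C * \<epsilon> n) \<longlonglongrightarrow> 0" using tendsto_mult_right_zero by blast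
  have "(\<lambda>n. dist (P n) e) \<longlonglongrightarrow> 0"
  proof (rule Lim_null_comparison[OF _ \<epsilon>0], intro always_eventually allI)
    show "norm (dist (P n) e) \<le> \<epsilon> n" for n using PQ(1)[of n] by (simp add: dist_commute)
  qed
  then have Pe: "P \<longlonglongrightarrow> e" by (subst tendsto_dist_iff)
  have "N (Q n) \<le> 1 + C" for n
  proof -
    have "C * \<epsilon> n \<le> C * 1" using C by (intro mult_left_mono) (auto simp: \<epsilon>_def)
    then show ?thesis using PQ(2)[of n] by (auto simp: near_def)
  qed
  then have "\<forall>n. Q n \<in> {x. N x \<le> 1 + C}" by blast
  then obtain q r where r: "strict_mono r" "(Q \<circ> r) \<longlonglongrightarrow> q"
    using compact_N_le[of "1 + C"] unfolding compact_def by metis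
  have Pr: "(\<lambda>n. P (r n)) \<longlonglongrightarrow> e" using LIMSEQ_subseq_LIMSEQ[OF Pe r(1)] by (simp add: o_def)
  have Qr: "(\<lambda>n. Q (r n)) \<longlonglongrightarrow> q" using r(2) by (simp add: o_def)
  have Cr: "(\<lambda>n. C * \<epsilon> (r n)) \<longlonglongrightarrow> 0" using LIMSEQ_subseq_LIMSEQ[OF C\<epsilon> r(1)] by (simp add: o_def)
  have to1: "x = 1" if "(\<lambda>n. f (r n)) \<longlonglongrightarrow> x" "\<And>n. \<bar>f n - 1\<bar> \<le> C * \<epsilon> n" for f x
  proof -
    have "(\<lambda>n. f (r n) - 1) \<longlonglongrightarrow> 0"
      by (rule Lim_null_comparison[OF _ Cr]) (use that(2) in auto)
    then have "(\<lambda>n. f (r n)) \<longlonglongrightarrow> 1" by (simp add: LIM_zero_iff)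
    then show ?thesis using LIMSEQ_unique that(1) by blast
  qed
  have Nq: "N q = 1"
    by (rule to1[of "\<lambda>n. N (Q n)"]) (use PQ(2) in \<open>auto simp: near_def intro!: tendsto_intros Qr\<close>)
  have Nqe: "N (q - e) = 1"
    by (rule to1[of "\<lambda>n. N (Q n - P n)"]) (use PQ(2) in \<open>auto simp: near_def intro!: tendsto_intros Qr Pr\<close>)
  have w: "(\<lambda>n. wedge (P (r n)) (Q (r n))) \<longlonglongrightarrow> wedge e q" by (intro tendsto_intros Pr Qr)
  have w0: "0 \<le> wedge e q"
    using PQ(2) by (intro LIMSEQ_le_const[OF w]) (auto simp: near_def less_imp_le)
  have wD: "wedge e q \<le> D"
    using PQ(2) by (intro LIMSEQ_le_const2[OF w]) (auto simp: near_def)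
  have "wedge e q \<noteq> 0"
  proof
    assume "wedge e q = 0"
    then obtain c where c: "q = c *\<^sub>R e" using wedge_eq_0_imp_scale[of e q] Ne N_zero by (metis zero_neq_one)
    then have "q - e = (c - 1) *\<^sub>R e" by (simp add: algebra_simps)
    then have "\<bar>c\<bar> = 1" "\<bar>c - 1\<bar> = 1" using Nq Nqe Ne c by (auto simp: scale)
    then show False by linarith
  qed
  then have h: "hex e q" using w0 Ne Nq Nqe by (simp add: hex_def)
  then show thesis using that critical_determinant_le_hex[OF h] wD by force
qed

lemma D_pos: "0 < D"
proof -
  obtain e where "e extreme_point_of {x. N x \<le> 1}" by (rule exists_extreme_point)
  then obtain Q where "hex e Q" "wedge e Q = D" by (rule extreme_point_hex)
  then show ?thesis using hexD(4) by metis
qed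

end

section \<open>Critical hexagons along the boundary\<close>

context plane_norm
begin

definition dir :: "real \<Rightarrow> real^2" where
  "dir \<theta> = vector [cos \<theta>, sin \<theta>]"

definition pt :: "real \<Rightarrow> real^2" where
  "pt \<theta> = (1 / N (dir \<theta>)) *\<^sub>R dir \<theta>"

lemma dir_nonzero: "dir \<theta> \<noteq> 0"
proof
  assume "dir \<theta> = 0"
  then have "dir \<theta> $ 1 = 0" "dir \<theta> $ 2 = 0" by simp_all
  then show False using sin_cos_squared_add[of \<theta>] by (simp add: dir_def)
qed

lemma N_dir_pos: "0 < N (dir \<theta>)"
  by (rule pos[OF dir_nonzero])

lemma N_pt [simp]: "N (pt \<theta>) = 1"
  using N_dir_pos[of \<theta>] by (simp add: pt_def scale)

lemma continuous_on_dir [continuous_intros]: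
  "continuous_on S f \<Longrightarrow> continuous_on S (\<lambda>x. dir (f x))"
proof -
  assume f: "continuous_on S f"
  have eq: "dir = (\<lambda>\<theta>. \<chi> i. if i = 1 then cos \<theta> else sin \<theta>)"
    by (auto simp: fun_eq_iff dir_def vec_eq_iff forall_2)
  have "continuous_on S (\<lambda>x. if i = 1 then cos (f x) else sin (f x))" for i :: 2
    using f by (cases "i = 1") (simp_all add: continuous_on_compose2[OF continuous_on_cos[OF continuous_on_id[of UNIV]]]
        continuous_on_compose2[OF continuous_on_sin[OF continuous_on_id[of UNIV]]])
  then show ?thesis unfolding eq by (rule continuous_on_vec_lambda)
qed

lemma continuous_on_pt [continuous_intros]:
  "continuous_on S f \<Longrightarrow> continuous_on S (\<lambda>x. pt (f x))"
  unfolding pt_def using N_dir_pos by (intro continuous_intros) (auto simp: less_imp_neq[THEN not_sym])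

lemma pt_plus_pi: "pt (\<theta> + pi) = - pt \<theta>"
proof -
  have "dir (\<theta> + pi) = - dir \<theta>" by (simp add: dir_def vec_eq_iff forall_2)
  then show ?thesis by (simp add: pt_def)
qed

lemma pt_minus_pi: "pt (\<theta> - pi) = - pt \<theta>"
  using pt_plus_pi[of "\<theta> - pi"] by simp

lemma wedge_pt: "wedge (pt \<theta>) (pt \<eta>) = sin (\<eta> - \<theta>) / (N (dir \<theta>) * N (dir \<eta>))"
  by (simp add: pt_def wedge_simps) (simp add: dir_def wedge_def sin_diff algebra_simps)

lemma wedge_pt_pos_iff:
  assumes "\<bar>\<eta> - \<theta>\<bar> \<le> pi"
  shows "0 < wedge (pt \<theta>) (pt \<eta>) \<longleftrightarrow> \<theta> < \<eta> \<and> \<eta> < \<theta> + pi"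
proof -
  have "0 < wedge (pt \<theta>) (pt \<eta>) \<longleftrightarrow> 0 < sin (\<eta> - \<theta>)"
    using mult_pos_pos[OF N_dir_pos[of \<theta>] N_dir_pos[of \<eta>]] by (simp add: wedge_pt zero_less_divide_iff)
  also have "\<dots> \<longleftrightarrow> \<theta> < \<eta> \<and> \<eta> < \<theta> + pi"
  proof
    assume s: "0 < sin (\<eta> - \<theta>)"
    have "\<not> \<eta> \<le> \<theta>" using s sin_ge_zero[of "\<theta> - \<eta>"] assms sin_minus[of "\<theta> - \<eta>"] by auto
    moreover have "\<eta> - \<theta> \<noteq> pi" using s by auto
    ultimately show "\<theta> < \<eta> \<and> \<eta> < \<theta> + pi" using assms by auto
  next
    assume "\<theta> < \<eta> \<and> \<eta> < \<theta> + pi"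
    then show "0 < sin (\<eta> - \<theta>)" by (intro sin_gt_zero) auto
  qed
  finally show ?thesis .
qed

lemma wedge_pt_nonneg:
  assumes "\<theta> \<le> \<eta>" "\<eta> \<le> \<theta> + pi"
  shows "0 \<le> wedge (pt \<theta>) (pt \<eta>)"
  using sin_ge_zero[of "\<eta> - \<theta>"] assms N_dir_pos[of \<theta>] N_dir_pos[of \<eta>] by (simp add: wedge_pt)

lemma pt_surj:
  assumes "N X = 1"
  obtains \<eta> where "\<theta> \<le> \<eta>" "\<eta> < \<theta> + 2 * pi" "X = pt \<eta>"
proof -
  have X0: "X \<noteq> 0" using assms by auto
  define a b where "a = X $ 1 / norm X" and "b = X $ 2 / norm X"
  have n2: "(norm X)\<^sup>2 = (X $ 1)\<^sup>2 + (X $ 2)\<^sup>2"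
    by (simp add: norm_vec_def L2_set_def sum_2)
  have "a\<^sup>2 + b\<^sup>2 = (norm X)\<^sup>2 / (norm X)\<^sup>2"
    by (simp only: a_def b_def power_divide n2 add_divide_distrib)
  then have "a\<^sup>2 + b\<^sup>2 = 1" using X0 by simp
  then obtain t where t: "a = cos t" "b = sin t" using sincos_total_2pi[of a b] by metis
  define k where "k = \<lceil>(\<theta> - t) / (2 * pi)\<rceil>"
  define \<eta> where "\<eta> = t + 2 * pi * of_int k"
  have k: "(\<theta> - t) / (2 * pi) \<le> of_int k" "of_int k < (\<theta> - t) / (2 * pi) + 1"
    unfolding k_def by linarith+
  have "\<theta> \<le> \<eta>" "\<eta> < \<theta> + 2 * pi"
    using k by (auto simp: \<eta>_def field_simps)
  moreover have "cos \<eta> = a" "sin \<eta> = b"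
    using t sin_int_2pin[of k] cos_int_2pin[of k] by (auto simp: \<eta>_def sin_add cos_add mult.commute)
  then have dX: "dir \<eta> = (1 / norm X) *\<^sub>R X"
    by (simp add: dir_def vec_eq_iff forall_2 a_def b_def)
  then have "X = pt \<eta>" using X0 assms by (simp add: pt_def scale)
  ultimately show thesis by (rule that)
qed

lemma pt_surj_half:
  assumes "N X = 1" "0 < wedge (pt \<theta>) X"
  obtains \<eta> where "\<theta> < \<eta>" "\<eta> < \<theta> + pi" "X = pt \<eta>"
proof -
  obtain \<eta> where \<eta>: "\<theta> \<le> \<eta>" "\<eta> < \<theta> + 2 * pi" "X = pt \<eta>" using pt_surj[OF assms(1)] by blast
  have "\<eta> \<le> \<theta> + pi"
  proof (rule ccontr)
    assume "\<not> \<eta> \<le> \<theta> + pi"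
    then have "0 < wedge (pt (\<theta> + pi)) (pt \<eta>)"
      using \<eta> by (subst wedge_pt_pos_iff) auto
    then show False using assms(2) \<eta>(3) by (simp add: pt_plus_pi wedge_simps)
  qed
  then have "\<theta> < \<eta> \<and> \<eta> < \<theta> + pi" using wedge_pt_pos_iff[of \<eta> \<theta>] assms(2) \<eta> by auto
  then show thesis using that \<eta>(3) by blast
qed

end

context irreducible_norm
begin

text \<open>Vertices of a critical hexagon that are neighbours, in terms of angles. Real angles, not points of the boundary or
  angles modulo \<open>2\<pi>\<close>, make the order of vertices a linear one. The weak inequalities make the relation closed; the strict
  ones follow from \<open>0 < D\<close>.\<close>

definition crit :: "real \<Rightarrow> real \<Rightarrow> bool" where
  "crit \<theta> \<eta> \<longleftrightarrow> \<theta> \<le> \<eta> \<and> \<eta> \<le> \<theta> + pi \<and> N (pt \<eta> - pt \<theta>) = 1 \<and> wedge (pt \<theta>) (pt \<eta>) = D"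

lemma crit_hex: "crit \<theta> \<eta> \<Longrightarrow> hex (pt \<theta>) (pt \<eta>)"
  using D_pos by (simp add: crit_def hex_def)

lemma crit_less: "crit \<theta> \<eta> \<Longrightarrow> \<theta> < \<eta> \<and> \<eta> < \<theta> + pi"
  using D_pos wedge_pt_pos_iff[of \<eta> \<theta>] by (auto simp: crit_def)

lemma hex_crit:
  assumes "hex (pt \<theta>) Q" "wedge (pt \<theta>) Q = D"
  obtains \<eta> where "crit \<theta> \<eta>" "Q = pt \<eta>"
proof -
  obtain \<eta> where "\<theta> < \<eta>" "\<eta> < \<theta> + pi" "Q = pt \<eta>"
    using pt_surj_half[of Q \<theta>] hexD[OF assms(1)] by blast
  then show thesis using that[of \<eta>] assms by (auto simp: crit_def hex_def)
qed

lemma crit_plus_pi: "crit \<theta> \<eta> \<Longrightarrow> crit (\<theta> + pi) (\<eta> + pi)"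
  using N_diff_commute by (auto simp: crit_def pt_plus_pi wedge_simps)

lemma crit_minus_pi: "crit \<theta> \<eta> \<Longrightarrow> crit (\<theta> - pi) (\<eta> - pi)"
  using N_diff_commute by (auto simp: crit_def pt_minus_pi wedge_simps)

lemma crit_third:
  assumes "crit \<theta> \<eta>"
  obtains \<zeta> where "crit \<eta> \<zeta>" "crit \<zeta> (\<theta> + pi)" "pt \<zeta> = pt \<eta> - pt \<theta>"
proof -
  have h: "hex (pt \<eta>) (pt \<eta> - pt \<theta>)" by (rule hex_rotate[OF crit_hex[OF assms]])
  have wD: "wedge (pt \<theta>) (pt \<eta>) = D" using assms by (simp add: crit_def)
  have "wedge (pt \<eta>) (pt \<eta> - pt \<theta>) = D"
    using wD wedge_commute[of "pt \<eta>" "pt \<theta>"] by (simp add: wedge_simps)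
  then obtain \<zeta> where \<zeta>: "crit \<eta> \<zeta>" "pt \<eta> - pt \<theta> = pt \<zeta>" using hex_crit[OF h] by blast
  have w2: "wedge (pt \<zeta>) (pt (\<theta> + pi)) = D"
    using wD wedge_commute[of "pt \<eta>" "pt \<theta>"] by (simp add: \<zeta>(2)[symmetric] pt_plus_pi wedge_simps)
  have o: "\<theta> < \<eta>" "\<eta> < \<theta> + pi" "\<eta> < \<zeta>" "\<zeta> < \<eta> + pi" using crit_less assms \<zeta>(1) by blast+
  then have "\<zeta> < \<theta> + pi" using wedge_pt_pos_iff[of "\<theta> + pi" \<zeta>] w2 D_pos by auto
  moreover have "N (pt (\<theta> + pi) - pt \<zeta>) = 1" by (simp add: \<zeta>(2)[symmetric] pt_plus_pi)
  ultimately have "crit \<zeta> (\<theta> + pi)" using w2 o by (simp add: crit_def)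
  then show thesis using that \<zeta> by simp
qed

lemma crit_predecessor:
  assumes "crit \<eta> \<zeta>"
  obtains \<theta> where "crit \<theta> \<eta>"
proof -
  obtain \<xi> where "crit \<xi> (\<eta> + pi)" using crit_third[OF assms] by blast
  then show thesis using that crit_minus_pi[of \<xi> "\<eta> + pi"] by simp
qed

lemma compact_crit: "compact {(\<theta>, \<eta>). crit \<theta> \<eta> \<and> a \<le> \<theta> \<and> \<theta> \<le> b}"
proof -
  have eq: "{(\<theta>, \<eta>). crit \<theta> \<eta> \<and> a \<le> \<theta> \<and> \<theta> \<le> b} = ({a..b} \<times> {a..b+pi}) \<inter>
     {x. fst x \<le> snd x \<and> snd x \<le> fst x + pi \<and> N (pt (snd x) - pt (fst x)) = 1 \<and>
       wedge (pt (fst x)) (pt (snd x)) = D}"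
    by (auto simp: crit_def)
  show ?thesis unfolding eq
    by (intro compact_Int_closed compact_Times compact_Icc closed_Collect_conj closed_Collect_le
        closed_Collect_eq continuous_intros)
qed

text \<open>Otherwise both points at \<open>\<theta>\<^sub>2\<close> and \<open>\<eta>\<^sub>2\<close> lie in the open sector between \<open>P\<close> and \<open>Q\<close>, with coordinates in \<open>(0, 1]\<close>
  by \<open>hex_coeff_le\<close>. The two determinants agree, so \<open>a d - b c = 1\<close>, but \<open>a d \<le> 1\<close> and \<open>b c > 0\<close>.\<close>

lemma crit_mono:
  assumes c1: "crit \<theta>\<^sub>1 \<eta>\<^sub>1" and c2: "crit \<theta>\<^sub>2 \<eta>\<^sub>2" and less: "\<theta>\<^sub>1 < \<theta>\<^sub>2"
  shows "\<eta>\<^sub>1 \<le> \<eta>\<^sub>2"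
proof (rule ccontr)
  assume "\<not> \<eta>\<^sub>1 \<le> \<eta>\<^sub>2"
  then have o: "\<theta>\<^sub>1 < \<theta>\<^sub>2" "\<theta>\<^sub>2 < \<eta>\<^sub>2" "\<eta>\<^sub>2 < \<eta>\<^sub>1" "\<eta>\<^sub>1 < \<theta>\<^sub>1 + pi"
    using less crit_less[OF c1] crit_less[OF c2] by auto
  define P Q where "P = pt \<theta>\<^sub>1" and "Q = pt \<eta>\<^sub>1"
  have h: "hex P Q" unfolding P_def Q_def by (rule crit_hex[OF c1])
  have w: "wedge P Q = D" using c1 by (simp add: crit_def P_def Q_def)
  have exp: "\<exists>a b. 0 < a \<and> 0 < b \<and> a \<le> 1 \<and> b \<le> 1 \<and> pt t = a *\<^sub>R P + b *\<^sub>R Q"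
    if "\<theta>\<^sub>1 < t" "t < \<eta>\<^sub>1" for t
  proof -
    have wp: "0 < wedge (pt t) Q" "0 < wedge P (pt t)"
      using that o unfolding P_def Q_def by (subst wedge_pt_pos_iff; auto)+
    define a b where "a = wedge (pt t) Q / D" and "b = wedge P (pt t) / D"
    have ab: "0 < a" "0 < b" using wp D_pos by (auto simp: a_def b_def)
    have "pt t = a *\<^sub>R P + b *\<^sub>R Q"
      using wedge_expand[of P Q "pt t"] w D_pos by (simp add: a_def b_def)
    moreover from this have "a \<le> 1" "b \<le> 1"
      using hex_coeff_le[OF h, of a b] ab N_pt[of t] by simp_all
    ultimately show ?thesis using ab by blast
  qed
  obtain a b where ab: "0 < a" "0 < b" "a \<le> 1" "b \<le> 1" "pt \<theta>\<^sub>2 = a *\<^sub>R P + b *\<^sub>R Q"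
    using exp[of \<theta>\<^sub>2] o by auto
  obtain c d where cd: "0 < c" "0 < d" "c \<le> 1" "d \<le> 1" "pt \<eta>\<^sub>2 = c *\<^sub>R P + d *\<^sub>R Q"
    using exp[of \<eta>\<^sub>2] o by auto
  have "wedge (pt \<theta>\<^sub>2) (pt \<eta>\<^sub>2) = (a * d - b * c) * D"
    by (simp add: ab cd wedge_simps wedge_commute[of Q P] w algebra_simps)
  then have "a * d - b * c = 1" using c2 D_pos by (simp add: crit_def)
  moreover have "a * d \<le> 1" using ab cd mult_mono[of a 1 d 1] by simp
  moreover have "0 < b * c" using ab cd by simp
  ultimately show False by linarith
qed

end

section \<open>Every boundary point is a vertex of a critical hexagon\<close>

context irreducible_norm
begin

lemma extreme_point_crit:
  assumes "pt t extreme_point_of {x. N x \<le> 1}"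
  obtains \<eta> where "crit t \<eta>"
  using extreme_point_hex[OF assms] hex_crit by metis

definition gap :: "real \<Rightarrow> real \<Rightarrow> bool" where
  "gap a b \<longleftrightarrow> (\<forall>t \<eta>. a < t \<longrightarrow> t < b \<longrightarrow> \<not> crit t \<eta>)"

text \<open>The closed disc is the convex hull of its extreme points. An extreme point beyond the chord of the arc would lie on
  the arc, because a negative coordinate with respect to the ends of the chord would make the other one exceed what the
  triangle inequality allows. But extreme points are vertices of critical hexagons, and the arc contains none.\<close>

lemma gap_support:
  assumes ab: "a < b" "b < a + pi" and g: "gap a b" and x: "N x \<le> 1"
  shows "wedge x (pt b - pt a) \<le> wedge (pt a) (pt b)"
proof -
  define w where "w = wedge (pt a) (pt b)"
  have w: "0 < w" using wedge_pt_pos_iff[of b a] ab by (simp add: w_def)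
  define H where "H = {x. wedge x (pt b - pt a) \<le> w}"
  have cH: "convex H" unfolding H_def convex_def
    by (auto simp: bilinear_ladd[OF bilinear_wedge] bilinear_lmul[OF bilinear_wedge] intro!: convex_bound_le)
  have ext: "e \<in> H" if e: "e extreme_point_of {x. N x \<le> 1}" for e
  proof (rule ccontr)
    assume "e \<notin> H"
    define c d where "c = wedge e (pt b) / w" and "d = wedge (pt a) e / w"
    have Ne: "N e = 1" by (rule extreme_point_N_eq_1[OF e])
    have ex: "e = c *\<^sub>R pt a + d *\<^sub>R pt b"
      using wedge_expand[of "pt a" "pt b" e] w by (simp add: c_def d_def w_def)
    have "wedge e (pt b - pt a) = (c + d) * w"
      using w by (simp add: c_def d_def field_simps wedge_simps wedge_commute[of e "pt a"])
    then have cd: "1 < c + d" using \<open>e \<notin> H\<close> w by (simp add: H_def)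
    have "d \<le> 1 + \<bar>c\<bar>" "c \<le> 1 + \<bar>d\<bar>"
      using N_diff_le[of e "c *\<^sub>R pt a"] N_diff_le[of e "d *\<^sub>R pt b"] Ne
      by (auto simp: ex scale abs_if split: if_splits)
    then have "0 < c" "0 < d" using cd by linarith+
    then have pos: "0 < wedge e (pt b)" "0 < wedge (pt a) e"
      using w by (simp_all add: c_def d_def zero_less_divide_iff)
    then obtain t where t: "a < t" "t < a + pi" "e = pt t" using pt_surj_half[OF Ne] by blast
    then have "t < b" using pos(1) wedge_pt_pos_iff[of b t] ab by auto
    then show False using extreme_point_crit[of t] e t g by (auto simp: gap_def)
  qed
  have "x \<in> convex hull {x. x extreme_point_of {x. N x \<le> 1}}"
    using x Krein_Milman_Minkowski[OF compact_N_le convex_N_le, of 1] by blast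
  also have "\<dots> \<subseteq> H" using ext cH by (intro hull_minimal) auto
  finally show ?thesis by (simp add: H_def w_def)
qed

lemma gap_segment:
  assumes ab: "a \<le> b" "b < a + pi" and g: "gap a b" and s: "0 \<le> s" "s \<le> 1"
  shows "N ((1 - s) *\<^sub>R pt a + s *\<^sub>R pt b) = 1"
proof (cases "a = b")
  case True
  then show ?thesis by (simp flip: scaleR_add_left)
next
  case False
  then have ab': "a < b" using ab by simp
  define w where "w = wedge (pt a) (pt b)"
  have w: "0 < w" using wedge_pt_pos_iff[of b a] ab ab' by (simp add: w_def)
  let ?x = "(1 - s) *\<^sub>R pt a + s *\<^sub>R pt b"
  have le: "N ?x \<le> 1" using N_comb[of "1 - s" s "pt a" "pt b"] s by simp
  have "1 \<le> N ?x"
  proof (rule ccontr)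
    assume lt: "\<not> 1 \<le> N ?x"
    have f: "wedge ?x (pt b - pt a) = w"
      by (simp add: wedge_simps w_def wedge_commute[of "pt b" "pt a"] algebra_simps)
    have "?x \<noteq> 0"
    proof
      assume "?x = 0"
      with f w show False by (simp only: bilinear_lzero[OF bilinear_wedge])
    qed
    then have Nx: "0 < N ?x" by (rule pos)
    have "wedge ((1 / N ?x) *\<^sub>R ?x) (pt b - pt a) \<le> w"
      unfolding w_def by (rule gap_support[OF ab' ab(2) g]) (use Nx in \<open>simp add: scale\<close>)
    then have "w / N ?x \<le> w" using f by (simp add: bilinear_lmul[OF bilinear_wedge])
    then show False using lt Nx w by (simp add: field_simps)
  qed
  then show ?thesis using le by simp
qed

lemma gap_point_on_segment:
  assumes ab: "a < t" "t < b" "b < a + pi" and g: "gap a b"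
  obtains s where "0 < s" "s < 1" "pt t = (1 - s) *\<^sub>R pt a + s *\<^sub>R pt b"
proof -
  define w where "w = wedge (pt a) (pt b)"
  have w: "0 < w" using wedge_pt_pos_iff[of b a] ab by (simp add: w_def)
  define c d where "c = wedge (pt t) (pt b) / w" and "d = wedge (pt a) (pt t) / w"
  have cd: "0 < c" "0 < d"
    using w wedge_pt_pos_iff[of b t] wedge_pt_pos_iff[of t a] ab by (auto simp: c_def d_def)
  have ex: "pt t = c *\<^sub>R pt a + d *\<^sub>R pt b"
    using wedge_expand[of "pt a" "pt b" "pt t"] w by (simp add: c_def d_def w_def)
  have "1 \<le> c + d" using N_comb[of c d "pt a" "pt b"] cd N_pt[of t] by (simp add: ex)
  moreover have "c + d \<le> 1"
  proof -
    have "wedge (pt t) (pt b - pt a) = (c + d) * w"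
      using w by (simp add: c_def d_def field_simps wedge_simps wedge_commute[of "pt t" "pt a"])
    moreover have "wedge (pt t) (pt b - pt a) \<le> w"
      unfolding w_def using ab by (intro gap_support[OF _ _ g]) auto
    ultimately show ?thesis using w by simp
  qed
  ultimately have "c = 1 - d" by linarith
  then show thesis using that[of d] ex cd by simp
qed

text \<open>Starting from \<open>\<theta>\<close>, the hexagon with consecutive vertices \<open>t\<close> and \<open>\<theta> + \<pi>\<close> has \<open>t\<close> as its third vertex.\<close>

lemma crit_back:
  assumes "crit t (\<theta> + pi)"
  obtains \<eta> where "crit \<theta> \<eta>" "crit \<eta> t" "pt t = pt \<eta> - pt \<theta>"
proof -
  obtain y where y: "crit (\<theta> + pi) y" "crit y (t + pi)" "pt y = pt (\<theta> + pi) - pt t"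
    using crit_third[OF assms] by blast
  show thesis
  proof (rule that[of "y - pi"])
    show "crit \<theta> (y - pi)" "crit (y - pi) t"
      using crit_minus_pi[OF y(1)] crit_minus_pi[OF y(2)] by simp_all
    show "pt t = pt (y - pi) - pt \<theta>" using y(3) by (simp add: pt_minus_pi pt_plus_pi)
  qed
qed

lemma pt_neq: "a < b \<Longrightarrow> b < a + pi \<Longrightarrow> pt a \<noteq> pt b"
  using wedge_pt_pos_iff[of b a] by auto

text \<open>A critical hexagon with a vertex between \<open>\<zeta>\<^sub>1\<close> and \<open>\<zeta>\<^sub>2\<close> has its next vertex between \<open>\<theta>\<^sub>1 + \<pi>\<close> and
  \<open>\<theta>\<^sub>2 + \<pi>\<close> by interlacing, hence at one of these two ends. Going back from the end, the extremal choice of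
  \<open>\<eta>\<^sub>1\<close> and \<open>\<eta>\<^sub>2\<close> is contradicted.\<close>

lemma gap_third:
  assumes c1: "crit \<theta>\<^sub>1 \<eta>\<^sub>1" "crit \<eta>\<^sub>1 \<zeta>\<^sub>1" "crit \<zeta>\<^sub>1 (\<theta>\<^sub>1 + pi)" "pt \<zeta>\<^sub>1 = pt \<eta>\<^sub>1 - pt \<theta>\<^sub>1"
    and c2: "crit \<theta>\<^sub>2 \<eta>\<^sub>2" "crit \<eta>\<^sub>2 \<zeta>\<^sub>2" "crit \<zeta>\<^sub>2 (\<theta>\<^sub>2 + pi)" "pt \<zeta>\<^sub>2 = pt \<eta>\<^sub>2 - pt \<theta>\<^sub>2"
    and g: "gap \<theta>\<^sub>1 \<theta>\<^sub>2"
    and last: "\<And>x. crit \<theta>\<^sub>1 x \<Longrightarrow> x \<le> \<eta>\<^sub>1" and first: "\<And>x. crit \<theta>\<^sub>2 x \<Longrightarrow> \<eta>\<^sub>2 \<le> x"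
  shows "gap \<zeta>\<^sub>1 \<zeta>\<^sub>2"
  unfolding gap_def
proof (intro allI impI notI)
  fix t x assume t: "\<zeta>\<^sub>1 < t" "t < \<zeta>\<^sub>2" "crit t x"
  have "\<theta>\<^sub>1 + pi \<le> x" using crit_mono[OF c1(3) t(3) t(1)] .
  moreover have "x \<le> \<theta>\<^sub>2 + pi" using crit_mono[OF t(3) c2(3) t(2)] .
  moreover obtain y where "crit x y" using crit_third[OF t(3)] by blast
  then have "crit (x - pi) (y - pi)" by (rule crit_minus_pi)
  then have "\<not> (\<theta>\<^sub>1 < x - pi \<and> x - pi < \<theta>\<^sub>2)" using g by (auto simp: gap_def)
  ultimately consider "x = \<theta>\<^sub>1 + pi" | "x = \<theta>\<^sub>2 + pi" by fastforce
  then show False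
  proof cases
    case 1
    then obtain \<eta> where \<eta>: "crit \<theta>\<^sub>1 \<eta>" "crit \<eta> t" "pt t = pt \<eta> - pt \<theta>\<^sub>1" using crit_back t(3) by metis
    show False
    proof (cases "\<eta> = \<eta>\<^sub>1")
      case True
      then have "pt t = pt \<zeta>\<^sub>1" using \<eta> c1(4) by simp
      moreover have "t < \<zeta>\<^sub>1 + pi" using crit_less[OF t(3)] 1 crit_less[OF c1(1)] crit_less[OF c1(2)] by linarith
      ultimately show False using pt_neq[of \<zeta>\<^sub>1 t] t by simp
    next
      case False
      then have "\<eta> < \<eta>\<^sub>1" using last[OF \<eta>(1)] by simp
      from crit_mono[OF \<eta>(2) c1(2) this] show False using t by simp
    qed
  next
    case 2
    then obtain \<eta> where \<eta>: "crit \<theta>\<^sub>2 \<eta>" "crit \<eta> t" "pt t = pt \<eta> - pt \<theta>\<^sub>2" using crit_back t(3) by metis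
    show False
    proof (cases "\<eta> = \<eta>\<^sub>2")
      case True
      then have "pt t = pt \<zeta>\<^sub>2" using \<eta> c2(4) by simp
      moreover have "\<zeta>\<^sub>2 < t + pi" using crit_less[OF t(3)] 2 crit_less[OF c2(3)] by linarith
      ultimately show False using pt_neq[of t \<zeta>\<^sub>2] t by simp
    next
      case False
      then have "\<eta>\<^sub>2 < \<eta>" using first[OF \<eta>(1)] by simp
      from crit_mono[OF c2(2) \<eta>(2) this] show False using t by simp
    qed
  qed
qed

text \<open>Interlacing places the predecessor of a vertex between \<open>\<eta>\<^sub>1\<close> and \<open>\<eta>\<^sub>2\<close> weakly between \<open>\<theta>\<^sub>1\<close> and \<open>\<theta>\<^sub>2\<close>; the
  extremal choice of \<open>\<eta>\<^sub>1\<close> and \<open>\<eta>\<^sub>2\<close> excludes the two ends.\<close>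

lemma gap_second:
  assumes c1: "crit \<theta>\<^sub>1 \<eta>\<^sub>1" and c2: "crit \<theta>\<^sub>2 \<eta>\<^sub>2" and g: "gap \<theta>\<^sub>1 \<theta>\<^sub>2"
    and last: "\<And>x. crit \<theta>\<^sub>1 x \<Longrightarrow> x \<le> \<eta>\<^sub>1" and first: "\<And>x. crit \<theta>\<^sub>2 x \<Longrightarrow> \<eta>\<^sub>2 \<le> x"
  shows "gap \<eta>\<^sub>1 \<eta>\<^sub>2"
  unfolding gap_def
proof (intro allI impI notI)
  fix t x assume t: "\<eta>\<^sub>1 < t" "t < \<eta>\<^sub>2" "crit t x"
  obtain s where s: "crit s t" using crit_predecessor[OF t(3)] by blast
  consider "s < \<theta>\<^sub>1" | "s = \<theta>\<^sub>1" | "\<theta>\<^sub>1 < s \<and> s < \<theta>\<^sub>2" | "s = \<theta>\<^sub>2" | "\<theta>\<^sub>2 < s" by linarith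
  then show False
    using crit_mono[OF s c1] crit_mono[OF c2 s] s last[of t] first[of t] g t
    by cases (auto simp: gap_def)
qed

text \<open>All three arcs are segments, so the points dividing them in the ratio \<open>s : 1 - s\<close> form an inscribed hexagon. Its
  determinant is \<open>D - s (1 - s) d\<close> where \<open>d\<close> is the determinant of the edge directions \<open>P2 - P1\<close> and \<open>Q2 - Q1\<close>. By
  convexity the second edge is turned counterclockwise against the first, so \<open>d \<ge> 0\<close>. The hexagon is thus
  critical and has a vertex in the gap.\<close>

lemma gap_empty:
  assumes c1: "crit \<theta>\<^sub>1 \<eta>\<^sub>1" and c2: "crit \<theta>\<^sub>2 \<eta>\<^sub>2" and g: "gap \<theta>\<^sub>1 \<theta>\<^sub>2"
    and last: "\<And>x. crit \<theta>\<^sub>1 x \<Longrightarrow> x \<le> \<eta>\<^sub>1" and first: "\<And>x. crit \<theta>\<^sub>2 x \<Longrightarrow> \<eta>\<^sub>2 \<le> x"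
    and t: "\<theta>\<^sub>1 < t" "t < \<theta>\<^sub>2"
  shows "False"
proof -
  obtain \<zeta>\<^sub>1 where z1: "crit \<eta>\<^sub>1 \<zeta>\<^sub>1" "crit \<zeta>\<^sub>1 (\<theta>\<^sub>1 + pi)" "pt \<zeta>\<^sub>1 = pt \<eta>\<^sub>1 - pt \<theta>\<^sub>1"
    using crit_third[OF c1] by blast
  obtain \<zeta>\<^sub>2 where z2: "crit \<eta>\<^sub>2 \<zeta>\<^sub>2" "crit \<zeta>\<^sub>2 (\<theta>\<^sub>2 + pi)" "pt \<zeta>\<^sub>2 = pt \<eta>\<^sub>2 - pt \<theta>\<^sub>2"
    using crit_third[OF c2] by blast
  have g2: "gap \<eta>\<^sub>1 \<eta>\<^sub>2" by (rule gap_second[OF c1 c2 g last first])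
  have g3: "gap \<zeta>\<^sub>1 \<zeta>\<^sub>2" by (rule gap_third[OF c1 z1 c2 z2 g last first])
  have o: "\<theta>\<^sub>1 < \<eta>\<^sub>1" "\<eta>\<^sub>1 < \<theta>\<^sub>1 + pi" "\<theta>\<^sub>2 < \<eta>\<^sub>2" "\<eta>\<^sub>2 < \<theta>\<^sub>2 + pi" "\<eta>\<^sub>1 < \<zeta>\<^sub>1" "\<zeta>\<^sub>2 < \<theta>\<^sub>2 + pi"
    using crit_less c1 c2 z1 z2 by blast+
  have o1: "\<theta>\<^sub>2 \<le> \<eta>\<^sub>1" using g z1(1) o(1) by (force simp: gap_def)
  have o2: "\<eta>\<^sub>2 \<le> \<theta>\<^sub>1 + pi" using g2 crit_plus_pi[OF c1] o(2) by (force simp: gap_def)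
  have o3: "\<eta>\<^sub>1 \<le> \<eta>\<^sub>2" using crit_mono[OF c1 c2] t by simp
  have o4: "\<zeta>\<^sub>1 \<le> \<zeta>\<^sub>2" using crit_mono[OF z2(2) z1(2)] t by force
  define P1 P2 Q1 Q2 where "P1 = pt \<theta>\<^sub>1" and "P2 = pt \<theta>\<^sub>2" and "Q1 = pt \<eta>\<^sub>1" and "Q2 = pt \<eta>\<^sub>2"
  note defs = P1_def P2_def Q1_def Q2_def
  obtain s where s: "0 < s" "s < 1" "pt t = (1 - s) *\<^sub>R P1 + s *\<^sub>R P2"
    unfolding defs using gap_point_on_segment[OF t(1) t(2) _ g] o o1 by auto
  define Q where "Q = (1 - s) *\<^sub>R Q1 + s *\<^sub>R Q2"
  have NQ: "N Q = 1" unfolding Q_def defs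
    using s o o2 by (intro gap_segment[OF o3 _ g2]) auto
  have "Q - pt t = (1 - s) *\<^sub>R pt \<zeta>\<^sub>1 + s *\<^sub>R pt \<zeta>\<^sub>2"
    by (simp add: Q_def s(3) z1(3) z2(3) defs algebra_simps)
  then have NR: "N (Q - pt t) = 1"
    using s o o1 by (simp add: gap_segment[OF o4 _ g3])
  have w11: "wedge P1 Q1 = D" "wedge P2 Q2 = D" using c1 c2 by (simp_all add: crit_def defs)
  have w12: "0 \<le> wedge P1 Q2" "0 \<le> wedge P2 Q1" "0 \<le> wedge Q1 Q2"
    unfolding defs using o o1 o2 o3 t by (auto intro!: wedge_pt_nonneg)
  have wPQ: "wedge (pt t) Q = (1 - s) * (1 - s) * D + s * s * D + s * (1 - s) * (wedge P1 Q2 + wedge P2 Q1)"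
    by (simp add: s(3) Q_def wedge_simps w11 algebra_simps)
  \<comment> \<open>The sign of \<open>d\<close>: the functional \<open>f\<close> is maximal on the edge \<open>[P1, P2]\<close>, and \<open>d = f Q1 - f Q2\<close>. Now\<close>
  \<comment> \<open>\<open>f Q2 \<le> f Q1\<close> since \<open>Q2\<close> lies between \<open>Q1\<close> and \<open>- P1\<close>; the coordinates satisfy \<open>1 \<le> a + b\<close> and \<open>a \<le> 1 + b\<close>.\<close>
  define f w where "f x = wedge x (P2 - P1)" and "w = wedge P1 P2" for x
  have w0: "0 < w" using wedge_pt_pos_iff[of \<theta>\<^sub>2 \<theta>\<^sub>1] t o o1 by (simp add: w_def defs)
  have f_le: "f x \<le> w" if "N x \<le> 1" for x
    unfolding f_def w_def defs using t o o1 that by (intro gap_support[OF _ _ g]) auto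
  define a b where "a = wedge P1 Q2 / D" and "b = wedge Q1 Q2 / D"
  have ab: "0 \<le> a" "0 \<le> b" using w12 D_pos by (auto simp: a_def b_def)
  have Q2: "Q2 = a *\<^sub>R Q1 - b *\<^sub>R P1"
    using wedge_expand[of P1 Q1 Q2] w11 D_pos wedge_commute[of Q1 Q2] by (simp add: a_def b_def add.commute)
  have N1: "N P1 = 1" "N Q1 = 1" "N Q2 = 1" by (simp_all add: defs)
  have ab1: "1 \<le> a + b" using N_diff_le[of "a *\<^sub>R Q1" "b *\<^sub>R P1"] ab N1 by (simp add: scale flip: Q2)
  have ab2: "a \<le> 1 + b"
    using triangle[of Q2 "b *\<^sub>R P1"] ab N1 by (simp add: scale Q2)
  have fQ1: "f Q1 \<le> w" "- f Q1 \<le> w"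
    using f_le[of Q1] f_le[of "- Q1"] N1 by (simp_all add: f_def wedge_simps)
  have "(a - 1) * f Q1 \<le> b * w"
  proof (cases "1 \<le> a")
    case True
    then have "(a - 1) * f Q1 \<le> (a - 1) * w" using fQ1 by (intro mult_left_mono) auto
    also have "\<dots> \<le> b * w" using ab2 w0 by (intro mult_right_mono) auto
    finally show ?thesis .
  next
    case False
    then have "(1 - a) * (- f Q1) \<le> (1 - a) * w" using fQ1 by (intro mult_left_mono) auto
    also have "\<dots> \<le> b * w" using ab1 w0 by (intro mult_right_mono) auto
    finally show ?thesis by (simp add: algebra_simps)
  qed
  moreover have "f P1 = w" by (simp add: f_def w_def wedge_simps)
  then have "f Q2 = a * f Q1 - b * w" by (simp add: Q2 f_def wedge_simps algebra_simps)
  ultimately have "f Q2 \<le> f Q1" by (simp add: algebra_simps)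
  then have cross: "wedge P1 Q2 + wedge P2 Q1 \<le> 2 * D"
    using w11 by (simp add: f_def wedge_simps wedge_commute[of Q1] wedge_commute[of Q2])
  have "s * (1 - s) * (wedge P1 Q2 + wedge P2 Q1) \<le> s * (1 - s) * (2 * D)"
    using cross s by (intro mult_left_mono) auto
  then have "wedge (pt t) Q \<le> (1 - s) * (1 - s) * D + s * s * D + s * (1 - s) * (2 * D)"
    unfolding wPQ by simp
  also have "\<dots> = D" by (simp add: algebra_simps)
  finally have wle: "wedge (pt t) Q \<le> D" .
  have "0 < (1 - s) * (1 - s) * D" "0 \<le> s * s * D" "0 \<le> s * (1 - s) * (wedge P1 Q2 + wedge P2 Q1)"
    using s D_pos w12 by simp_all
  then have "0 < wedge (pt t) Q" unfolding wPQ by linarith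
  then have h: "hex (pt t) Q" using NQ NR by (simp add: hex_def)
  have "wedge (pt t) Q = D" using wle critical_determinant_le_hex[OF h] by simp
  then obtain \<eta> where "crit t \<eta>" using hex_crit[OF h] by blast
  then show False using g t by (simp add: gap_def)
qed

text \<open>The vertices of critical hexagons form a closed set of angles; a missing angle would lie in a maximal gap.\<close>

theorem every_angle_crit: obtains \<eta> where "crit \<theta> \<eta>"
proof (rule ccontr)
  assume "\<not> thesis"
  then have bad: "\<not> crit \<theta> \<eta>" for \<eta> using that by blast
  obtain e where e: "e extreme_point_of {x. N x \<le> 1}" by (rule exists_extreme_point)
  have below_above: "\<exists>t \<eta>. crit t \<eta> \<and> c \<le> t \<and> t \<le> c + 2 * pi" for c
  proof -
    obtain t where "c \<le> t" "t < c + 2 * pi" "e = pt t"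
      using pt_surj[OF extreme_point_N_eq_1[OF e], of c] by blast
    moreover from this obtain \<eta> where "crit t \<eta>" using extreme_point_crit e by blast
    ultimately show ?thesis by force
  qed
  define S where "S a b = {(\<theta>, \<eta>). crit \<theta> \<eta> \<and> a \<le> \<theta> \<and> \<theta> \<le> b}" for a b
  have S: "compact (S a b)" for a b unfolding S_def by (rule compact_crit)
  have max: "\<exists>p\<in>S a b. \<forall>q\<in>S a b. h q \<le> h p" and min: "\<exists>p\<in>S a b. \<forall>q\<in>S a b. h p \<le> h q"
    if "S a b \<noteq> {}" "continuous_on UNIV h" for a b and h :: "real \<times> real \<Rightarrow> real"
    using continuous_attains_sup[OF S that(1)] continuous_attains_inf[OF S that(1)]
      continuous_on_subset[OF that(2) subset_UNIV] by blast+
  have cf: "continuous_on UNIV (fst :: real \<times> real \<Rightarrow> real)" "continuous_on UNIV (snd :: real \<times> real \<Rightarrow> real)"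
    by (intro continuous_intros)+
  have "S (\<theta> - 2 * pi) \<theta> \<noteq> {}" using below_above[of "\<theta> - 2 * pi"] by (auto simp: S_def)
  from max[OF this cf(1)] obtain \<theta>\<^sub>1 x where 1: "crit \<theta>\<^sub>1 x" "\<theta> - 2 * pi \<le> \<theta>\<^sub>1" "\<theta>\<^sub>1 \<le> \<theta>"
    "\<And>t y. crit t y \<Longrightarrow> \<theta> - 2 * pi \<le> t \<Longrightarrow> t \<le> \<theta> \<Longrightarrow> t \<le> \<theta>\<^sub>1" by (auto simp: S_def)
  have "S \<theta> (\<theta> + 2 * pi) \<noteq> {}" using below_above[of "\<theta>"] by (auto simp: S_def)
  from min[OF this cf(1)] obtain \<theta>\<^sub>2 y where 2: "crit \<theta>\<^sub>2 y" "\<theta> \<le> \<theta>\<^sub>2" "\<theta>\<^sub>2 \<le> \<theta> + 2 * pi"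
    "\<And>t y. crit t y \<Longrightarrow> \<theta> \<le> t \<Longrightarrow> t \<le> \<theta> + 2 * pi \<Longrightarrow> \<theta>\<^sub>2 \<le> t" by (auto simp: S_def)
  have "S \<theta>\<^sub>1 \<theta>\<^sub>1 \<noteq> {}" using 1(1) by (auto simp: S_def)
  from max[OF this cf(2)] obtain p where p: "p \<in> S \<theta>\<^sub>1 \<theta>\<^sub>1" "\<forall>q\<in>S \<theta>\<^sub>1 \<theta>\<^sub>1. snd q \<le> snd p" by blast
  define \<eta>\<^sub>1 where "\<eta>\<^sub>1 = snd p"
  have \<eta>1: "crit \<theta>\<^sub>1 \<eta>\<^sub>1" "\<And>x. crit \<theta>\<^sub>1 x \<Longrightarrow> x \<le> \<eta>\<^sub>1"
    using p by (force simp: S_def \<eta>\<^sub>1_def dest: order.antisym)+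
  have "S \<theta>\<^sub>2 \<theta>\<^sub>2 \<noteq> {}" using 2(1) by (auto simp: S_def)
  from min[OF this cf(2)] obtain p' where p': "p' \<in> S \<theta>\<^sub>2 \<theta>\<^sub>2" "\<forall>q\<in>S \<theta>\<^sub>2 \<theta>\<^sub>2. snd p' \<le> snd q" by blast
  define \<eta>\<^sub>2 where "\<eta>\<^sub>2 = snd p'"
  have \<eta>2: "crit \<theta>\<^sub>2 \<eta>\<^sub>2" "\<And>x. crit \<theta>\<^sub>2 x \<Longrightarrow> \<eta>\<^sub>2 \<le> x"
    using p' by (force simp: S_def \<eta>\<^sub>2_def dest: order.antisym)+
  have g: "gap \<theta>\<^sub>1 \<theta>\<^sub>2"
    unfolding gap_def
  proof (intro allI impI notI)
    fix t x assume t: "\<theta>\<^sub>1 < t" "t < \<theta>\<^sub>2" "crit t x"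
    show False
      using 1(4)[OF t(3)] 2(4)[OF t(3)] t 1(2) 2(3) by (cases "t \<le> \<theta>") auto
  qed
  have "\<theta>\<^sub>1 < \<theta>" "\<theta> < \<theta>\<^sub>2" using bad 1 2 by (metis order_le_less)+
  then show False using gap_empty[OF \<eta>1(1) \<eta>2(1) g \<eta>1(2) \<eta>2(2)] by blast
qed

end

section \<open>Uniqueness of the critical hexagon\<close>

locale irreducible_nonparallelogram = irreducible_norm +
  assumes not_parallelogram: "\<not> open_parallelogram {x. N x < 1}"
begin

lemma crit_limit:
  assumes "\<sigma> \<longlonglongrightarrow> \<theta>" "\<And>n. crit (\<sigma> n) (\<eta> n)"
  obtains \<eta>' r where "strict_mono (r :: nat \<Rightarrow> nat)" "(\<lambda>n. \<eta> (r n)) \<longlonglongrightarrow> \<eta>'" "crit \<theta> \<eta>'"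
proof -
  have "Bseq \<sigma>" using assms(1) convergent_imp_Bseq convergent_def by blast
  then obtain B where "\<And>n. \<bar>\<sigma> n\<bar> \<le> B" by (auto simp: Bseq_def)
  then have B: "- B \<le> \<sigma> n" "\<sigma> n \<le> B" for n by (simp_all add: abs_le_iff minus_le_iff)
  let ?S = "{(\<theta>, \<eta>). crit \<theta> \<eta> \<and> - B \<le> \<theta> \<and> \<theta> \<le> B}"
  have mem: "\<forall>n. (\<sigma> n, \<eta> n) \<in> ?S" using assms(2) B by auto
  have sc: "seq_compact ?S" using compact_crit compact_eq_seq_compact_metric by blast
  obtain l r where l: "l \<in> ?S" "strict_mono r" "((\<lambda>n. (\<sigma> n, \<eta> n)) \<circ> r) \<longlonglongrightarrow> l"
    by (rule seq_compactE[OF sc mem])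
  have "(\<lambda>n. \<sigma> (r n)) \<longlonglongrightarrow> fst l" "(\<lambda>n. \<eta> (r n)) \<longlonglongrightarrow> snd l"
    using tendsto_fst[OF l(3)] tendsto_snd[OF l(3)] by (simp_all add: o_def)
  moreover have "(\<lambda>n. \<sigma> (r n)) \<longlonglongrightarrow> \<theta>" using LIMSEQ_subseq_LIMSEQ[OF assms(1) l(2)] by (simp add: o_def)
  ultimately have "fst l = \<theta>" using LIMSEQ_unique by blast
  then show thesis using that[OF l(2)] \<open>(\<lambda>n. \<eta> (r n)) \<longlonglongrightarrow> snd l\<close> l(1) by auto
qed

lemma tendsto_pt: "(f \<longlongrightarrow> x) F \<Longrightarrow> ((\<lambda>n. pt (f n)) \<longlongrightarrow> pt x) F"
  using continuous_on_tendsto_compose[OF continuous_on_pt[OF continuous_on_id[of UNIV]]] by auto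

text \<open>The hypotheses say that \<open>A\<close> lies inside an edge parallel to \<open>P = pt \<theta>\<close>, at the height of critical hexagons. Take
  coordinates \<open>x P + y A\<close>: then \<open>y \<le> 1\<close> on the closed disc, and a supporting line at \<open>P\<close> reads \<open>x - k y \<le> 1\<close>. For a
  critical hexagon whose first vertex is near \<open>P\<close> and slightly further on, these two bounds and the value of the
  determinant force the second vertex to satisfy \<open>x \<le> k\<close>; if the first vertex is slightly before \<open>P\<close>, the third vertex
  satisfies \<open>x \<ge> k\<close>. In the limit this produces two hexagons with vertex \<open>P\<close> whose sides on the line \<open>y = 1\<close> together reach from
  \<open>(k - 1) P + A\<close> or before to \<open>(k + 1) P + A\<close> or beyond. With \<open>V = A + k P\<close> the disc contains the parallelogram with vertices
  \<open>\<plusminus>V \<plusminus> P\<close>, and the two supporting lines show that it is no larger.\<close>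

lemma no_flat_point:
  assumes A: "N A = 1" "wedge (pt \<theta>) A = D"
    and r: "0 < r" "N (A - r *\<^sub>R pt \<theta>) \<le> 1" and s: "0 < s" "N (A + s *\<^sub>R pt \<theta>) \<le> 1"
  shows False
proof -
  define P where "P = pt \<theta>"
  have NP: "N P = 1" and PA: "wedge P A = D" using A by (simp_all add: P_def)
  have AP: "wedge A P = - D" using PA wedge_commute[of A P] by simp
  have A_min: "1 \<le> N (A + v *\<^sub>R P)" for v
  proof (cases "0 \<le> v")
    case True
    have "N A \<le> N (A + (v / r) *\<^sub>R (r *\<^sub>R P))"
      using True r A by (intro N_ray_ge) (auto simp: P_def)
    then show ?thesis using r A by simp
  next
    case False
    have "N A \<le> N (A + (- v / s) *\<^sub>R (- s *\<^sub>R P))"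
      using False s A by (intro N_ray_ge) (auto simp: P_def divide_le_0_iff)
    then show ?thesis using s A by simp
  qed
  have coord: "Z = (wedge Z A / D) *\<^sub>R P + (wedge P Z / D) *\<^sub>R A" for Z
    using wedge_expand[of P A Z] PA D_pos by simp
  have height: "wedge P Z / D \<le> N Z" for Z
  proof (rule ccontr)
    define y where "y = wedge P Z / D"
    assume "\<not> ?thesis"
    then have y: "N Z < y" "0 < y" using N_nonneg[of Z] by (auto simp: y_def)
    have "(1 / y) *\<^sub>R Z = (1 / y) *\<^sub>R ((wedge Z A / D) *\<^sub>R P + y *\<^sub>R A)"
      using coord[of Z] by (simp add: y_def)
    also have "\<dots> = A + (wedge Z A / D / y) *\<^sub>R P" using y by (simp add: scaleR_add_right add.commute)
    finally have "1 \<le> N ((1 / y) *\<^sub>R Z)" using A_min by simp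
    then show False using y by (simp add: scale)
  qed
  obtain a where a: "a \<bullet> P = 1" "\<And>x. a \<bullet> x \<le> N x" using support_functional[OF NP] by blast
  define k where "k = - (a \<bullet> A)"
  obtain \<alpha> where \<alpha>: "\<theta> < \<alpha>" "\<alpha> < \<theta> + pi" "A = pt \<alpha>"
    using pt_surj_half[OF A(1), of \<theta>] A(2) D_pos by auto
  \<comment> \<open>With \<open>pt \<phi> = p P + t A\<close> and \<open>Z = x P + y A\<close> the claim is \<open>t x \<le> k t\<close>: the determinant gives\<close>
  \<comment> \<open>\<open>p y - t x = 1\<close>, the height gives \<open>y \<le> 1\<close>, and the supporting line at \<open>P\<close> gives \<open>p - k t \<le> 1\<close>.\<close>
  have key: "(wedge P (pt \<phi>) / D) * (wedge Z A / D) \<le> k * (wedge P (pt \<phi>) / D)"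
    if "0 < wedge (pt \<phi>) A" "N Z \<le> 1" "wedge (pt \<phi>) Z = D" for \<phi> Z
  proof -
    define p t x y where "p = wedge (pt \<phi>) A / D" and "t = wedge P (pt \<phi>) / D"
      and "x = wedge Z A / D" and "y = wedge P Z / D"
    have p: "0 < p" using that(1) D_pos by (simp add: p_def)
    have e1: "pt \<phi> = p *\<^sub>R P + t *\<^sub>R A" unfolding p_def t_def by (rule coord)
    have e2: "Z = x *\<^sub>R P + y *\<^sub>R A" unfolding x_def y_def by (rule coord)
    have "D = (p * y - t * x) * D"
      using that(3) by (subst (asm) e1, subst (asm) e2) (simp add: wedge_simps PA AP algebra_simps)
    then have "p * y - t * x = 1" using D_pos by simp
    moreover have "y \<le> 1" using height[of Z] that(2) by (simp add: y_def)
    then have "p * y \<le> p" using p by simp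
    moreover have "p - t * k \<le> 1" using a(2)[of "pt \<phi>"] a(1) by (simp add: e1 k_def inner_add_right del: N_pt)
       (metis N_pt e1)
    ultimately show ?thesis unfolding t_def[symmetric] x_def[symmetric] by (simp add: mult.commute)
  qed
  have "\<exists>x. crit \<phi> x" for \<phi> by (rule every_angle_crit) blast
  then obtain h where h: "\<And>\<phi>. crit \<phi> (h \<phi>)" by metis
  have lim: "(\<lambda>n. \<theta> + d / real (Suc (Suc n))) \<longlonglongrightarrow> \<theta>" for d
  proof -
    have "(\<lambda>n. d / real (Suc n)) \<longlonglongrightarrow> 0" by (rule LIMSEQ_Suc[OF lim_const_over_n])
    then have "(\<lambda>n. d / real (Suc (Suc n))) \<longlonglongrightarrow> 0" by (rule LIMSEQ_Suc)
    from tendsto_add[OF tendsto_const[of \<theta>] this] show ?thesis by simp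
  qed
  have small: "0 < d / real (Suc (Suc n)) \<and> d / real (Suc (Suc n)) < d" if "0 < d" for d n
    using that by (simp add: divide_less_eq)
  \<comment> \<open>First vertices beyond \<open>P\<close>, where \<open>t > 0\<close>; they stay before \<open>\<alpha>\<close>, so that \<open>p > 0\<close>.\<close>
  obtain \<eta> where \<eta>: "crit \<theta> \<eta>" "wedge (pt \<eta>) A / D \<le> k"
  proof -
    define \<sigma> where "\<sigma> n = \<theta> + (\<alpha> - \<theta>) / real (Suc (Suc n))" for n
    have \<sigma>: "\<theta> < \<sigma> n" "\<sigma> n < \<alpha>" for n using small[of "\<alpha> - \<theta>" n] \<alpha> by (auto simp: \<sigma>_def)
    have \<sigma>l: "\<sigma> \<longlonglongrightarrow> \<theta>" unfolding \<sigma>_def by (rule lim)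
    have le: "wedge (pt (h (\<sigma> n))) A / D \<le> k" for n
    proof -
      have "0 < wedge (pt (\<sigma> n)) A" "0 < wedge P (pt (\<sigma> n))"
        unfolding \<alpha>(3) P_def using \<sigma>[of n] \<alpha> by (subst wedge_pt_pos_iff; auto)+
      then have "(wedge P (pt (\<sigma> n)) / D) * (wedge (pt (h (\<sigma> n))) A / D) \<le> k * (wedge P (pt (\<sigma> n)) / D)"
        using h[of "\<sigma> n"] by (intro key) (auto simp: crit_def)
      moreover have "0 < wedge P (pt (\<sigma> n)) / D" using \<open>0 < wedge P (pt (\<sigma> n))\<close> D_pos by simp
      ultimately show ?thesis by (simp only: mult.commute[of k] mult_le_cancel_left_pos)
    qed
    obtain \<eta>' r where "strict_mono r" and l: "(\<lambda>n. h (\<sigma> (r n))) \<longlonglongrightarrow> \<eta>'" "crit \<theta> \<eta>'"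
      using crit_limit[OF \<sigma>l, of "\<lambda>n. h (\<sigma> n)"] h by blast
    have "(\<lambda>n. wedge (pt (h (\<sigma> (r n)))) A / D) \<longlonglongrightarrow> wedge (pt \<eta>') A / D"
      using D_pos by (intro tendsto_intros tendsto_pt l) auto
    then have "wedge (pt \<eta>') A / D \<le> k" by (rule LIMSEQ_le_const2) (use le in blast)
    then show thesis using that l by blast
  qed
  \<comment> \<open>First vertices before \<open>P\<close>, where \<open>t < 0\<close>; here the third vertex plays the role of \<open>Z\<close>.\<close>
  obtain \<eta>' where \<eta>': "crit \<theta> \<eta>'" "k \<le> wedge (pt \<eta>' - P) A / D"
  proof -
    define \<sigma> where "\<sigma> n = \<theta> + (- (\<theta> + pi - \<alpha>)) / real (Suc (Suc n))" for n
    have \<sigma>: "\<sigma> n < \<theta>" "\<alpha> - pi < \<sigma> n" for n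
      using small[of "\<theta> + pi - \<alpha>" n] \<alpha> unfolding \<sigma>_def minus_divide_left[symmetric] by linarith+
    have \<sigma>l: "\<sigma> \<longlonglongrightarrow> \<theta>" unfolding \<sigma>_def by (rule lim)
    have le: "k \<le> wedge (pt (h (\<sigma> n)) - pt (\<sigma> n)) A / D" for n
    proof -
      have w: "0 < wedge (pt (\<sigma> n)) A" "0 < wedge (pt (\<sigma> n)) P"
        unfolding \<alpha>(3) P_def using \<sigma>[of n] \<alpha> by (subst wedge_pt_pos_iff; auto)+
      have "(wedge P (pt (\<sigma> n)) / D) * (wedge (pt (h (\<sigma> n)) - pt (\<sigma> n)) A / D) \<le> k * (wedge P (pt (\<sigma> n)) / D)"
        using h[of "\<sigma> n"] w by (intro key) (auto simp: crit_def wedge_simps)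
      moreover have "wedge P (pt (\<sigma> n)) / D < 0"
        using w(2) wedge_commute[of P "pt (\<sigma> n)"] D_pos by simp
      ultimately show ?thesis by (simp only: mult.commute[of k] mult_le_cancel_left_neg)
    qed
    obtain \<eta>' r where r: "strict_mono r" and l: "(\<lambda>n. h (\<sigma> (r n))) \<longlonglongrightarrow> \<eta>'" "crit \<theta> \<eta>'"
      using crit_limit[OF \<sigma>l, of "\<lambda>n. h (\<sigma> n)"] h by blast
    have "(\<lambda>n. \<sigma> (r n)) \<longlonglongrightarrow> \<theta>" using LIMSEQ_subseq_LIMSEQ[OF \<sigma>l r] by (simp add: o_def)
    then have "(\<lambda>n. wedge (pt (h (\<sigma> (r n))) - pt (\<sigma> (r n))) A / D) \<longlonglongrightarrow> wedge (pt \<eta>' - P) A / D"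
      unfolding P_def using D_pos by (intro tendsto_intros tendsto_pt l) auto
    then have "k \<le> wedge (pt \<eta>' - P) A / D" by (rule LIMSEQ_le_const) (use le in blast)
    then show thesis using that l by blast
  qed
  define V where "V = A + k *\<^sub>R P"
  define x x' where "x = wedge (pt \<eta>) A / D" and "x' = wedge (pt \<eta>' - P) A / D"
  have xk: "x \<le> k" "k \<le> x'" using \<eta> \<eta>' by (simp_all add: x_def x'_def)
  have "pt \<eta> = x *\<^sub>R P + A"
    using coord[of "pt \<eta>"] \<eta>(1) D_pos by (simp add: x_def crit_def P_def)
  moreover have "N (pt \<eta> - P) = 1" using \<eta>(1) by (simp add: crit_def P_def)
  ultimately have left: "N (A + (x - 1) *\<^sub>R P) \<le> 1" by (simp add: algebra_simps)
  have "wedge P (pt \<eta>' - P) / D = 1" using \<eta>'(1) D_pos by (simp add: crit_def P_def wedge_simps)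
  with coord[of "pt \<eta>' - P"] have "pt \<eta>' - P = x' *\<^sub>R P + 1 *\<^sub>R A"
    unfolding x'_def by (simp only:)
  then have "pt \<eta>' = A + (x' + 1) *\<^sub>R P" by (simp add: algebra_simps)
  then have right: "N (A + (x' + 1) *\<^sub>R P) \<le> 1" using N_pt[of \<eta>'] by simp
  have between: "N (A + v *\<^sub>R P) \<le> 1" if "x - 1 \<le> v" "v \<le> x' + 1" for v
  proof -
    define c where "c = (v - (x - 1)) / (x' + 1 - (x - 1))"
    have len: "0 < x' + 1 - (x - 1)" using xk by simp
    have c: "0 \<le> c" "c \<le> 1" using that len by (auto simp: c_def)
    have "c * (x' + 1 - (x - 1)) = v - (x - 1)" using len by (simp add: c_def)
    then have "v = (1 - c) * (x - 1) + c * (x' + 1)" by (simp add: algebra_simps)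
    moreover have "(1 - c) *\<^sub>R (A + p *\<^sub>R P) + c *\<^sub>R (A + q *\<^sub>R P) = A + ((1 - c) * p + c * q) *\<^sub>R P" for p q
      by (simp add: algebra_simps)
    ultimately have "A + v *\<^sub>R P = (1 - c) *\<^sub>R (A + (x - 1) *\<^sub>R P) + c *\<^sub>R (A + (x' + 1) *\<^sub>R P)"
      by simp
    then show ?thesis
      using convexD[OF convex_N_le[of 1], of "A + (x - 1) *\<^sub>R P" "A + (x' + 1) *\<^sub>R P" "1 - c" c] left right c
      by simp
  qed
  have VP: "N (V + P) \<le> 1" "N (V - P) \<le> 1"
    using between[of "k + 1"] between[of "k - 1"] xk by (simp_all add: V_def algebra_simps)
  have PV: "wedge P V = D" using PA by (simp add: V_def wedge_simps)
  have aV: "a \<bullet> V = 0" using a(1) by (simp add: V_def k_def inner_add_right inner_diff_right)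
  have repr: "Z = (a \<bullet> Z) *\<^sub>R P + (wedge P Z / D) *\<^sub>R V" for Z
  proof -
    define c d where "c = wedge Z V / D" and "d = wedge P Z / D"
    have "Z = c *\<^sub>R P + d *\<^sub>R V"
      using wedge_expand[of P V Z] PV D_pos by (simp add: c_def d_def)
    moreover from this have "a \<bullet> Z = c" using a(1) aV by (simp add: inner_add_right)
    ultimately show ?thesis by (simp add: d_def)
  qed
  have "disc = {(- P - V) + s *\<^sub>R (2 *\<^sub>R P) + t *\<^sub>R (2 *\<^sub>R V) | s t. 0 < s \<and> s < 1 \<and> 0 < t \<and> t < 1}"
    (is "_ = ?para")
  proof
    show "disc \<subseteq> ?para"
    proof
      fix Z assume "Z \<in> disc"
      define c d where "c = a \<bullet> Z" and "d = wedge P Z / D"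
      have cd: "c < 1" "- 1 < c" "d < 1" "- 1 < d"
        using a(2)[of Z] a(2)[of "- Z"] height[of Z] height[of "- Z"] \<open>Z \<in> disc\<close>
        by (auto simp: c_def d_def wedge_simps)
      have "0 < (c + 1) / 2" "(c + 1) / 2 < 1" "0 < (d + 1) / 2" "(d + 1) / 2 < 1" using cd by simp_all
      moreover have "Z = (- P - V) + ((c + 1) / 2) *\<^sub>R (2 *\<^sub>R P) + ((d + 1) / 2) *\<^sub>R (2 *\<^sub>R V)"
      proof -
        have half: "((r + 1) / 2) *\<^sub>R (2 *\<^sub>R W) = r *\<^sub>R W + W" for r and W :: "real^2"
        proof -
          have "(r + 1) / 2 * 2 = r + 1" by simp
          then show ?thesis by (simp only: scaleR_scaleR scaleR_add_left scaleR_one)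
        qed
        show ?thesis unfolding half using repr[of Z] by (simp add: c_def d_def)
      qed
      ultimately show "Z \<in> ?para" by blast
    qed
    show "?para \<subseteq> disc"
    proof safe
      fix s t :: real assume st: "0 < s" "s < 1" "0 < t" "t < 1"
      have "(- P - V) + s *\<^sub>R (2 *\<^sub>R P) + t *\<^sub>R (2 *\<^sub>R V) = (s + t - 1) *\<^sub>R (V + P) + (t - s) *\<^sub>R (V - P)"
        by (simp add: vec_eq_iff algebra_simps)
      then have "N ((- P - V) + s *\<^sub>R (2 *\<^sub>R P) + t *\<^sub>R (2 *\<^sub>R V)) \<le> \<bar>s + t - 1\<bar> * N (V + P) + \<bar>t - s\<bar> * N (V - P)"
        by (metis triangle scale)
      also have "\<dots> \<le> \<bar>s + t - 1\<bar> * 1 + \<bar>t - s\<bar> * 1" using VP by (intro add_mono mult_left_mono) auto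
      also have "\<dots> < 1" using st by (auto simp: abs_if)
      finally show "N ((- P - V) + s *\<^sub>R (2 *\<^sub>R P) + t *\<^sub>R (2 *\<^sub>R V)) < 1" .
    qed
  qed
  moreover have "independent {2 *\<^sub>R P, 2 *\<^sub>R V} \<and> 2 *\<^sub>R P \<noteq> 2 *\<^sub>R V"
  proof -
    have w: "wedge (2 *\<^sub>R P) (2 *\<^sub>R V) \<noteq> 0" using PV D_pos by (simp add: wedge_simps)
    then have ne: "2 *\<^sub>R P \<noteq> 2 *\<^sub>R V" by auto
    moreover have "2 *\<^sub>R P \<notin> span {2 *\<^sub>R V}"
    proof
      assume "2 *\<^sub>R P \<in> span {2 *\<^sub>R V}"
      then obtain x where e: "2 *\<^sub>R P = x *\<^sub>R (2 *\<^sub>R V)" by (auto simp: span_singleton)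
      from w show False unfolding e by (simp add: wedge_simps)
    qed
    moreover have "2 *\<^sub>R V \<noteq> 0" using w by (auto simp: wedge_simps)
    ultimately show ?thesis by (simp add: independent_insert)
  qed
  ultimately have "open_parallelogram disc" unfolding open_parallelogram_def by blast
  then show False using not_parallelogram by simp
qed

text \<open>Two second vertices have the same height over \<open>P\<close>. If they differed by \<open>v P\<close> with \<open>v > 0\<close>, the first of them would lie
  inside an edge, between its translates by \<open>- P\<close> and \<open>v P\<close>.\<close>

lemma crit_unique:
  assumes "crit \<theta> \<eta>" "crit \<theta> \<eta>'"
  shows "\<eta> = \<eta>'"
proof -
  have neq: False if c: "crit \<theta> x" "crit \<theta> y" and e: "pt y = pt x + v *\<^sub>R pt \<theta>" "0 < v" for x y v
  proof (rule no_flat_point)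
    show "N (pt x) = 1" by simp
    show "wedge (pt \<theta>) (pt x) = D" "N (pt x - 1 *\<^sub>R pt \<theta>) \<le> 1" using c(1) by (simp_all add: crit_def)
    show "N (pt x + v *\<^sub>R pt \<theta>) \<le> 1" unfolding e(1)[symmetric] by simp
  qed (use e(2) in simp_all)
  have "wedge (pt \<theta>) (pt \<eta>' - pt \<eta>) = 0" using assms by (simp add: crit_def wedge_simps)
  then obtain v where v: "pt \<eta>' - pt \<eta> = v *\<^sub>R pt \<theta>"
    using wedge_eq_0_imp_scale[of "pt \<theta>"] N_pt[of \<theta>] N_zero by (metis zero_neq_one)
  have "pt \<eta>' = pt \<eta>"
  proof (rule ccontr)
    assume "pt \<eta>' \<noteq> pt \<eta>"
    then consider "0 < v" | "0 < - v" using v by force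
    then show False
    proof cases
      case 1
      then show False using neq[OF assms, of v] v by (simp add: algebra_simps)
    next
      case 2
      have "pt \<eta> = pt \<eta>' + (- v) *\<^sub>R pt \<theta>" using v by (simp add: algebra_simps)
      then show False using neq[OF assms(2,1)] 2 by blast
    qed
  qed
  then show ?thesis
    using pt_neq[of \<eta> \<eta>'] pt_neq[of \<eta>' \<eta>] crit_less[OF assms(1)] crit_less[OF assms(2)]
    by (metis add.commute add_strict_right_mono linorder_neqE_linordered_idom order_less_trans)
qed

text \<open>The chain of inequalities in the reduction is tight, so the shortest vector \<open>P\<close> is a boundary point and the chord
  \<open>[X - P, X]\<close> lies on the line of the second basis vector. It contains a lattice point, which must be an end of the
  chord: an inner one would be a flat point.\<close>

lemma critical_obtain_crit:
  assumes "critical disc \<Lambda>"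
  obtains \<theta> \<eta> where "crit \<theta> \<eta>" "\<Lambda> = lat (pt \<theta>) (pt \<eta>)"
proof -
  have adm: "admissible disc \<Lambda>" and cov: "covolume \<Lambda> = D" using assms by (auto simp: critical_def)
  obtain P Q X where PQ: "\<Lambda> = lat P Q" "0 < wedge P Q" "1 \<le> N P"
    and min: "\<And>k::int. N P \<le> N (Q + of_int k *\<^sub>R P)"
    and X: "hex ((1 / N P) *\<^sub>R P) X" and le: "(N P)\<^sup>2 * wedge ((1 / N P) *\<^sub>R P) X \<le> wedge P Q"
    using admissible_reduction[OF adm] by metis
  have wD: "wedge P Q = D" using cov PQ by (simp add: covolume_lat)
  have "(N P)\<^sup>2 * D \<le> (N P)\<^sup>2 * wedge ((1 / N P) *\<^sub>R P) X"
    using critical_determinant_le_hex[OF X] by (intro mult_left_mono) auto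
  then have "(N P)\<^sup>2 * D \<le> 1 * D" using le wD by linarith
  then have "(N P)\<^sup>2 \<le> 1" using D_pos by (rule mult_right_le_imp_le)
  then have NP: "N P = 1" using PQ(3) by (simp add: power2_le_iff_abs_le abs_le_square_iff power_le_one_iff order_antisym)
  have hX: "hex P X" and wX: "wedge P X = D"
    using X le wD NP critical_determinant_le_hex[OF X] by simp_all
  have P0: "P \<noteq> 0" using NP by auto
  have "wedge P (Q - X) = 0" using wD wX by (simp add: wedge_simps)
  then obtain c where c: "Q - X = c *\<^sub>R P" using wedge_eq_0_imp_scale P0 by metis
  define k u where "k = - \<lceil>c\<rceil>" and "u = - (c + of_int k)"
  have u: "0 \<le> u" "u < 1" unfolding u_def k_def by linarith+
  define A where "A = Q + of_int k *\<^sub>R P"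
  have AX: "A = X - u *\<^sub>R P" using c by (simp add: A_def u_def algebra_simps)
  obtain \<theta> where \<theta>: "P = pt \<theta>" using pt_surj[OF NP] by metis
  have "u = 0"
  proof (rule ccontr)
    assume "u \<noteq> 0"
    have "A = (1 - u) *\<^sub>R X + u *\<^sub>R (X - P)" by (simp add: AX algebra_simps)
    then have "N A \<le> (1 - u) * N X + u * N (X - P)" using N_comb[of "1 - u" u] u by simp
    then have "N A = 1" using min[of k] NP hX by (simp add: A_def hex_def)
    moreover have "wedge (pt \<theta>) A = D" using wX \<theta> by (simp add: AX wedge_simps)
    moreover have "N (A - (1 - u) *\<^sub>R pt \<theta>) \<le> 1" "N (A + u *\<^sub>R pt \<theta>) \<le> 1"
      using hX by (simp_all add: AX \<theta>[symmetric] hex_def algebra_simps)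
    ultimately show False using no_flat_point[of A \<theta> "1 - u" u] u \<open>u \<noteq> 0\<close> by simp
  qed
  then have "X = Q + of_int k *\<^sub>R P" using AX by (simp add: A_def)
  then have "X \<in> lat P Q" by (simp add: lat_add lat_scale lat_basis_mem)
  then have "lat P X = \<Lambda>" unfolding PQ(1)
    using wX wD D_pos by (intro lat_eq_if_wedge_eq lat_basis_mem) auto
  moreover obtain \<eta> where "crit \<theta> \<eta>" "X = pt \<eta>" using hex_crit[of \<theta> X] hX wX \<theta> by metis
  ultimately show thesis using that \<theta> by blast
qed

lemma crit_critical: "crit \<theta> \<eta> \<Longrightarrow> critical disc (lat (pt \<theta>) (pt \<eta>))"
  using hex_admissible[OF crit_hex] covolume_lat[of "pt \<theta>" "pt \<eta>"] D_pos
  by (auto simp: critical_def crit_def)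

end

section \<open>The circle of critical lattices\<close>

text \<open>Equality of lattices as a closed condition on their bases, since \<open>\<int>\<close> is closed in the reals.\<close>

lemma lat_eq_iff_coordinates:
  assumes w: "wedge P Q = d" "0 < d"
  shows "lat A B = lat P Q \<longleftrightarrow> \<bar>wedge A B\<bar> = d \<and> wedge A Q / d \<in> \<int> \<and> wedge P A / d \<in> \<int> \<and>
     wedge B Q / d \<in> \<int> \<and> wedge P B / d \<in> \<int>" (is "_ \<longleftrightarrow> ?rhs")
proof
  have mem: "X \<in> lat P Q \<longleftrightarrow> wedge X Q / d \<in> \<int> \<and> wedge P X / d \<in> \<int>" for X
  proof
    assume "X \<in> lat P Q"
    then obtain m n :: int where "X = of_int m *\<^sub>R P + of_int n *\<^sub>R Q" by (auto simp: lat_def)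
    then show "wedge X Q / d \<in> \<int> \<and> wedge P X / d \<in> \<int>" using w by (simp add: wedge_simps)
  next
    assume "wedge X Q / d \<in> \<int> \<and> wedge P X / d \<in> \<int>"
    then obtain m n :: int where mn: "wedge X Q / d = of_int m" "wedge P X / d = of_int n"
      by (auto elim!: Ints_cases)
    have "X = of_int m *\<^sub>R P + of_int n *\<^sub>R Q"
      using wedge_expand[of P Q X] w by (simp add: mn[symmetric])
    then show "X \<in> lat P Q" by (simp only: lat_memI)
  qed
  {
    assume eq: "lat A B = lat P Q"
    have "wedge A B \<noteq> 0"
    proof
      assume AB: "wedge A B = 0"
      have "wedge X Y = 0" if XY: "X \<in> lat A B" "Y \<in> lat A B" for X Y
      proof -
        obtain m n m' n' :: int where "X = of_int m *\<^sub>R A + of_int n *\<^sub>R B" "Y = of_int m' *\<^sub>R A + of_int n' *\<^sub>R B"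
          using XY by (auto simp: lat_def)
        then show ?thesis using AB wedge_commute[of B A] by (simp add: wedge_simps)
      qed
      then have "wedge P Q = 0" unfolding eq using lat_basis_mem by blast
      then show False using w by simp
    qed
    then have "\<bar>wedge A B\<bar> = d" using covolume_lat[of A B] covolume_lat[of P Q] eq w by simp
    then show ?rhs using mem[of A] mem[of B] lat_basis_mem[of A B] lat_basis_mem[of B A] eq by auto
  }
  {
    assume r: ?rhs
    then show "lat A B = lat P Q" using mem w by (intro lat_eq_if_wedge_eq) auto
  }
qed

text \<open>The map \<open>t \<mapsto> cis (2\<pi>t)\<close> is a quotient map from the interval onto the circle, so \<open>\<phi>\<close> factors through it. Closed
  images are assumed in place of a Hausdorff target: for lattices they can be read off directly from matrices.\<close>

lemma loop_to_circle:
  fixes \<phi> :: "real \<Rightarrow> 'a"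
  assumes cont: "continuous_map (top_of_set {0..1}) X \<phi>" and loop: "\<phi> 0 = \<phi> 1"
    and inj: "inj_on \<phi> {0..<1}"
    and closed: "\<And>C. closed C \<Longrightarrow> C \<subseteq> {0..1} \<Longrightarrow> closedin X (\<phi> ` C)"
  shows "\<exists>\<psi> :: complex \<Rightarrow> 'a. (\<forall>t\<in>{0..1}. \<psi> (cis (2 * pi * t)) = \<phi> t) \<and>
      homeomorphic_map (top_of_set (sphere 0 1)) (subtopology X (\<phi> ` {0..1})) \<psi>"
proof -
  let ?I = "top_of_set {0..1::real}" and ?S = "top_of_set (sphere (0::complex) 1)"
  define q where "q t = cis (2 * pi * t)" for t
  define \<psi> where "\<psi> z = \<phi> (Arg2pi z / (2 * pi))" for z
  have Arg: "Arg2pi (q t) = 2 * pi * t" if "0 \<le> t" "t < 1" for t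
    by (rule Arg2pi_unique[of 1]) (use that in \<open>auto simp: q_def cis_conv_exp\<close>)
  have q1: "q 1 = q 0" by (simp add: q_def)
  have \<psi>q: "\<psi> (q t) = \<phi> t" if "t \<in> {0..1}" for t
  proof (cases "t = 1")
    case True
    then show ?thesis using Arg[of 0] loop q1 by (simp add: \<psi>_def)
  next
    case False
    then show ?thesis using Arg[of t] that by (simp add: \<psi>_def)
  qed
  have surj: "\<exists>t\<in>{0..<1}. z = q t" if "z \<in> sphere 0 1" for z
  proof
    show "Arg2pi z / (2 * pi) \<in> {0..<1}" using Arg2pi[of z] by auto
    show "z = q (Arg2pi z / (2 * pi))" using Arg2pi_eq[of z] that by (simp add: q_def cis_conv_exp)
  qed
  have qI: "q ` {0..1} = sphere 0 1"
  proof
    show "q ` {0..1} \<subseteq> sphere 0 1" by (auto simp: q_def)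
    show "sphere 0 1 \<subseteq> q ` {0..1}" using surj by fastforce
  qed
  have qc: "continuous_on A q" for A unfolding q_def by (intro continuous_intros)
  have qcm: "continuous_map ?I ?S q" using qc qI by auto
  have q: "quotient_map ?I ?S q"
  proof (rule continuous_imp_quotient_map[OF qcm])
    show "compact_space ?I" by (simp add: compact_space_subtopology)
    show "Hausdorff_space ?S" by (simp add: Hausdorff_space_subtopology)
  qed (use qI in auto)
  have "continuous_map ?I X (\<psi> \<circ> q)"
    by (rule continuous_map_eq[OF cont]) (use \<psi>q in auto)
  then have \<psi>c: "continuous_map ?S X \<psi>" by (rule continuous_compose_quotient_map[OF q])
  have im: "\<psi> ` sphere 0 1 = \<phi> ` {0..1}"
    unfolding qI[symmetric] image_image using \<psi>q by (intro image_cong) auto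
  have \<psi>cl: "closed_map ?S X \<psi>"
    unfolding closed_map_def
  proof (intro allI impI)
    fix K assume K: "closedin ?S K"
    define C where "C = {t \<in> {0..1}. q t \<in> K}"
    have "closedin ?I C" using closedin_continuous_map_preimage[OF qcm K] by (simp add: C_def)
    then have "closed C" using closedin_closed_trans closed_atLeastAtMost by blast
    then have "closedin X (\<phi> ` C)" by (rule closed) (auto simp: C_def)
    moreover have "\<psi> ` K = \<phi> ` C"
    proof -
      have "K \<subseteq> q ` {0..1}" using closedin_imp_subset[OF K] qI by simp
      then have "K = q ` C" unfolding C_def by blast
      moreover have "\<psi> ` q ` C = \<phi> ` C"
        unfolding image_image by (intro image_cong) (auto simp: C_def \<psi>q)
      ultimately show ?thesis by simp
    qed
    ultimately show "closedin X (\<psi> ` K)" by simp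
  qed
  have "homeomorphic_map ?S (subtopology X (\<phi> ` {0..1})) \<psi>"
  proof (rule bijective_closed_imp_homeomorphic_map)
    show "continuous_map ?S (subtopology X (\<phi> ` {0..1})) \<psi>"
      using \<psi>c im by (auto simp: continuous_map_in_subtopology)
    show "closed_map ?S (subtopology X (\<phi> ` {0..1})) \<psi>"
      using \<psi>cl im by (intro closed_map_into_subtopology) auto
    have "\<phi> ` {0..1} \<subseteq> topspace X" using continuous_map_image_subset_topspace[OF cont] by auto
    then show "\<psi> ` topspace ?S = topspace (subtopology X (\<phi> ` {0..1}))" using im by auto
    show "inj_on \<psi> (topspace ?S)"
    proof (rule inj_onI)
      fix z w assume "z \<in> topspace ?S" "w \<in> topspace ?S" and eq: "\<psi> z = \<psi> w"
      then obtain t u where tu: "t \<in> {0..<1}" "z = q t" "u \<in> {0..<1}" "w = q u"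
        using surj[of z] surj[of w] by auto
      then have "\<phi> t = \<phi> u" using eq \<psi>q[of t] \<psi>q[of u] by auto
      then show "z = w" using inj tu by (auto dest: inj_onD)
    qed
  qed
  moreover have "\<forall>t\<in>{0..1}. \<psi> (cis (2 * pi * t)) = \<phi> t" using \<psi>q by (simp add: q_def)
  ultimately show ?thesis by blast
qed

context irreducible_nonparallelogram
begin

definition tau :: "real \<Rightarrow> real" where "tau \<theta> = (THE \<eta>. crit \<theta> \<eta>)"

lemma crit_iff: "crit \<theta> \<eta> \<longleftrightarrow> \<eta> = tau \<theta>"
proof -
  obtain x where x: "crit \<theta> x" by (rule every_angle_crit)
  then have "tau \<theta> = x" unfolding tau_def using crit_unique by blast
  then show ?thesis using x crit_unique by blast
qed

lemma crit_tau: "crit \<theta> (tau \<theta>)"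
  by (simp add: crit_iff)

lemma tau_tau_tau: "tau (tau (tau \<theta>)) = \<theta> + pi"
  and pt_tau_tau: "pt (tau (tau \<theta>)) = pt (tau \<theta>) - pt \<theta>"
proof -
  obtain \<zeta> where \<zeta>: "crit (tau \<theta>) \<zeta>" "crit \<zeta> (\<theta> + pi)" "pt \<zeta> = pt (tau \<theta>) - pt \<theta>"
    using crit_third[OF crit_tau] by metis
  then have "\<zeta> = tau (tau \<theta>)" "\<theta> + pi = tau \<zeta>" by (simp_all only: crit_iff)
  then show "tau (tau (tau \<theta>)) = \<theta> + pi" "pt (tau (tau \<theta>)) = pt (tau \<theta>) - pt \<theta>"
    using \<zeta>(3) by simp_all
qed

text \<open>Interlacing gives weak monotonicity, and \<open>\<tau>\<^sup>3(\<theta>) = \<theta> + \<pi>\<close> injectivity.\<close>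

lemma strict_mono_tau: "strict_mono tau"
proof (rule strict_monoI)
  fix x y :: real assume "x < y"
  then have "tau x \<le> tau y" using crit_mono[OF crit_tau crit_tau] by blast
  moreover have "tau x \<noteq> tau y" using tau_tau_tau[of x] tau_tau_tau[of y] \<open>x < y\<close> by auto
  ultimately show "tau x < tau y" by simp
qed

lemma surj_tau: "surj tau"
  by (rule surjI[of _ "\<lambda>y. tau (tau (y - pi))"]) (simp add: tau_tau_tau)

lemma continuous_on_tau [continuous_intros]:
  "continuous_on S f \<Longrightarrow> continuous_on S (\<lambda>x. tau (f x))"
proof -
  have "continuous_on UNIV tau"
    by (rule continuous_onI_mono) (auto simp: surj_tau strict_mono_less_eq[OF strict_mono_tau])
  then show "continuous_on S f \<Longrightarrow> continuous_on S (\<lambda>x. tau (f x))"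
    using continuous_on_compose2 by blast
qed

definition crit_lattice :: "real \<Rightarrow> (real^2) set" where "crit_lattice \<theta> = lat (pt \<theta>) (pt (tau \<theta>))"

lemma crit_lattice_tau: "crit_lattice (tau \<theta>) = crit_lattice \<theta>"
  by (simp add: crit_lattice_def pt_tau_tau lat_rotate)

lemma crit_lattice_plus_pi: "crit_lattice (\<theta> + pi) = crit_lattice \<theta>"
  by (metis crit_lattice_tau tau_tau_tau)

lemma wedge_tau: "wedge (pt \<theta>) (pt (tau \<theta>)) = D"
  using crit_tau[of \<theta>] by (simp add: crit_def)

text \<open>Consecutive pairs of vertices of a hexagon span the same lattice, and the half turn from \<open>0\<close> to \<open>\<pi>\<close> consists of the three intervals
  \<open>[0, \<tau> 0)\<close>, \<open>[\<tau> 0, \<tau>\<^sup>2 0)\<close> and \<open>[\<tau>\<^sup>2 0, \<pi>)\<close>, each mapped onto the next one by \<open>\<tau>\<close>.\<close>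

lemma critical_imp_crit_lattice:
  assumes "critical disc \<Lambda>"
  obtains \<theta> where "0 \<le> \<theta>" "\<theta> < tau 0" "\<Lambda> = crit_lattice \<theta>"
proof -
  obtain \<theta> where \<theta>: "\<Lambda> = crit_lattice \<theta>"
    using critical_obtain_crit[OF assms] by (auto simp: crit_iff crit_lattice_def)
  obtain \<theta>' where \<theta>': "0 \<le> \<theta>'" "\<theta>' < 2 * pi" "pt \<theta> = pt \<theta>'"
    using pt_surj[OF N_pt[of \<theta>], of 0] by auto
  have "hex (pt \<theta>') (pt (tau \<theta>))" "wedge (pt \<theta>') (pt (tau \<theta>)) = D"
    using crit_hex[OF crit_tau[of \<theta>]] wedge_tau[of \<theta>] \<theta>'(3) by simp_all
  then have "pt (tau \<theta>) = pt (tau \<theta>')" by (metis hex_crit crit_iff)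
  then have eq': "\<Lambda> = crit_lattice \<theta>'" using \<theta> \<theta>'(3) by (simp add: crit_lattice_def)
  obtain \<alpha> where \<alpha>: "0 \<le> \<alpha>" "\<alpha> < pi" "\<Lambda> = crit_lattice \<alpha>"
  proof (cases "\<theta>' < pi")
    case True
    then show ?thesis using that[of \<theta>'] eq' \<theta>' by simp
  next
    case False
    then show ?thesis using that[of "\<theta>' - pi"] eq' \<theta>' crit_lattice_plus_pi[of "\<theta>' - pi"] by simp
  qed
  obtain \<beta> where \<beta>: "\<alpha> = tau \<beta>" using surj_tau by blast
  obtain \<gamma> where \<gamma>: "\<beta> = tau \<gamma>" using surj_tau by blast
  note less = strict_mono_less[OF strict_mono_tau] and le = strict_mono_less_eq[OF strict_mono_tau]
  show thesis
  proof (cases "\<alpha> < tau 0")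
    case True
    then show ?thesis using that \<alpha> by blast
  next
    case False
    then have b0: "0 \<le> \<beta>" using le[of 0 \<beta>] \<beta> by simp
    show ?thesis
    proof (cases "\<beta> < tau 0")
      case True
      then show ?thesis using that[of \<beta>] b0 \<alpha> \<beta> crit_lattice_tau by simp
    next
      case False
      then have "0 \<le> \<gamma>" using le[of 0 \<gamma>] \<gamma> by simp
      moreover have "tau (tau \<gamma>) < tau (tau (tau 0))" using \<alpha>(2) \<beta> \<gamma> by (simp add: tau_tau_tau)
      then have "\<gamma> < tau 0" by (simp add: less)
      ultimately show ?thesis using that[of \<gamma>] \<alpha> \<beta> \<gamma> crit_lattice_tau by simp
    qed
  qed
qed

text \<open>A lattice point on the boundary strictly between \<open>P\<close> and \<open>Q\<close> could only be \<open>P + Q\<close>. Then \<open>Q - P\<close>, \<open>Q\<close> and \<open>Q + P\<close> would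
  all be boundary points and \<open>Q\<close> a flat point.\<close>

lemma crit_lattice_neq:
  assumes "\<theta> < \<theta>'" "\<theta>' < tau \<theta>"
  shows "crit_lattice \<theta> \<noteq> crit_lattice \<theta>'"
proof
  assume "crit_lattice \<theta> = crit_lattice \<theta>'"
  define P Q where "P = pt \<theta>" and "Q = pt (tau \<theta>)"
  have "pt \<theta>' \<in> lat P Q" using \<open>crit_lattice \<theta> = crit_lattice \<theta>'\<close> lat_basis_mem(1) by (auto simp: crit_lattice_def P_def Q_def)
  then obtain m n :: int where mn: "pt \<theta>' = of_int m *\<^sub>R P + of_int n *\<^sub>R Q" by (auto simp: lat_def)
  have w: "wedge P Q = D" by (simp add: P_def Q_def wedge_tau)
  have h: "hex P Q" unfolding P_def Q_def by (rule crit_hex[OF crit_tau])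
  have "0 < wedge P (pt \<theta>')" "0 < wedge (pt \<theta>') Q"
    unfolding P_def Q_def using assms crit_less[OF crit_tau[of \<theta>]] by (subst wedge_pt_pos_iff; auto)+
  then have mn0: "0 < m" "0 < n"
    using D_pos by (simp_all add: mn wedge_simps w zero_less_mult_iff)
  then have "m \<le> 1" "n \<le> 1"
    using hex_coeff_le[OF h, of "of_int m" "of_int n"] N_pt[of \<theta>'] by (simp_all add: mn)
  then have "m = 1" "n = 1" using mn0 by auto
  then have "N (P + Q) = 1" using N_pt[of \<theta>'] mn by simp
  then show False
    using no_flat_point[of Q \<theta> 1 1] h w by (simp add: hex_def P_def[symmetric] add.commute)
qed

lemma continuous_map_crit_lattice: "continuous_on S f \<Longrightarrow> continuous_map (top_of_set S) lattice_space (\<lambda>x. crit_lattice (f x))"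
proof -
  assume f: "continuous_on S f"
  define h where "h x = cols (pt (f x)) (pt (tau (f x)))" for x
  have c: "continuous_on S (\<lambda>x. if j = 1 then pt (f x) $ i else pt (tau (f x)) $ i)" for i j :: 2
    using f by (cases "j = 1") (auto intro!: continuous_intros)
  have "continuous_on S h"
    unfolding h_def cols_def by (intro continuous_on_vec_lambda c)
  moreover have "invertible (h x)" for x
    using D_pos by (simp add: h_def invertible_cols wedge_tau)
  ultimately have "continuous_map (top_of_set S) (top_of_set {g. invertible g}) h" by auto
  moreover have "continuous_map (top_of_set {g. invertible g}) lattice_space lattice_of"
    unfolding lattice_space_def by (intro quotient_imp_continuous_map quotient_map_quotient_topology)
  ultimately have "continuous_map (top_of_set S) lattice_space (lattice_of \<circ> h)"
    by (rule continuous_map_compose)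
  then show ?thesis by (simp add: o_def h_def lattice_of_cols crit_lattice_def)
qed

text \<open>A set of lattices is closed iff the set of matrices spanning them is. The latter is here the projection of a
  closed set along the compact set \<open>C\<close>.\<close>

lemma closedin_crit_lattice_image:
  assumes "compact C"
  shows "closedin lattice_space (crit_lattice ` C)"
proof -
  let ?GL = "{g :: real^2^2. invertible g}"
  define E where "E = {x :: real \<times> (real^2^2). lat (column 1 (snd x)) (column 2 (snd x)) = crit_lattice (fst x)}"
  have E: "E = {x. \<bar>wedge (column 1 (snd x)) (column 2 (snd x))\<bar> = D}
     \<inter> (\<lambda>x. wedge (column 1 (snd x)) (pt (tau (fst x))) / D) -` \<int>
     \<inter> (\<lambda>x. wedge (pt (fst x)) (column 1 (snd x)) / D) -` \<int>
     \<inter> (\<lambda>x. wedge (column 2 (snd x)) (pt (tau (fst x))) / D) -` \<int>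
     \<inter> (\<lambda>x. wedge (pt (fst x)) (column 2 (snd x)) / D) -` \<int>"
    unfolding E_def crit_lattice_def by (auto simp: lat_eq_iff_coordinates[OF wedge_tau D_pos])
  have col: "continuous_on UNIV (\<lambda>x :: real \<times> (real^2^2). column j (snd x))" for j :: 2
    unfolding column_def by (intro continuous_intros)
  have "closed E" unfolding E using D_pos
    by (intro closed_Int closed_vimage closed_Collect_eq closed_Ints continuous_intros col) auto
  then have cl: "closedin (top_of_set (C \<times> ?GL)) (C \<times> ?GL \<inter> E)" by (rule closedin_closed_Int)
  have "{g \<in> ?GL. lattice_of g \<in> crit_lattice ` C} = {g. \<exists>t. t \<in> C \<and> (t, g) \<in> C \<times> ?GL \<inter> E}"
    by (auto simp: E_def lattice_of_eq_lat)
  then have c: "closedin (top_of_set ?GL) {g \<in> ?GL. lattice_of g \<in> crit_lattice ` C}"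
    using closedin_compact_projection[OF assms cl] by simp
  have "crit_lattice ` C \<subseteq> topspace lattice_space"
    using is_lattice_lat D_pos by (auto simp: topspace_lattice_space crit_lattice_def wedge_tau)
  moreover have "quotient_map (top_of_set ?GL) lattice_space lattice_of"
    unfolding lattice_space_def by (rule quotient_map_quotient_topology)
  ultimately show ?thesis using c by (auto simp: quotient_map_closedin)
qed

theorem critical_locus_circle:
  "\<exists>\<phi> :: real \<Rightarrow> (real^2) set.
    continuous_map (top_of_set {0..1}) lattice_space \<phi> \<and> \<phi> 0 = \<phi> 1 \<and>
    \<phi> ` {0..1} = critical_locus disc \<and>
    (\<exists>\<psi> :: complex \<Rightarrow> (real^2) set. (\<forall>t\<in>{0..1}. \<psi> (cis (2 * pi * t)) = \<phi> t) \<and>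
      homeomorphic_map (top_of_set (sphere 0 1)) (subtopology lattice_space (critical_locus disc)) \<psi>)"
proof -
  have T: "0 < tau 0" using crit_less[OF crit_tau[of 0]] by simp
  define \<phi> where "\<phi> t = crit_lattice (t * tau 0)" for t
  have cont: "continuous_map (top_of_set {0..1}) lattice_space \<phi>"
    unfolding \<phi>_def by (intro continuous_map_crit_lattice continuous_intros)
  have loop: "\<phi> 0 = \<phi> 1" by (simp add: \<phi>_def crit_lattice_tau)
  have im: "\<phi> ` {0..1} = critical_locus disc"
  proof
    show "\<phi> ` {0..1} \<subseteq> critical_locus disc"
      using crit_critical[OF crit_tau] by (auto simp: \<phi>_def crit_lattice_def critical_locus_def)
    show "critical_locus disc \<subseteq> \<phi> ` {0..1}"
    proof
      fix \<Lambda> assume "\<Lambda> \<in> critical_locus disc"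
      then obtain \<theta> where \<theta>: "0 \<le> \<theta>" "\<theta> < tau 0" "\<Lambda> = crit_lattice \<theta>"
        using critical_imp_crit_lattice by (auto simp: critical_locus_def)
      then have "\<Lambda> = \<phi> (\<theta> / tau 0)" "\<theta> / tau 0 \<in> {0..1}" using T by (auto simp: \<phi>_def)
      then show "\<Lambda> \<in> \<phi> ` {0..1}" by blast
    qed
  qed
  have neq: "\<phi> s \<noteq> \<phi> t" if "0 \<le> s" "s < t" "t < 1" for s t
    unfolding \<phi>_def
  proof (rule crit_lattice_neq)
    show "s * tau 0 < t * tau 0" using that T by simp
    have "t * tau 0 < tau 0" using that T by simp
    also have "\<dots> \<le> tau (s * tau 0)" using that T by (simp add: strict_mono_less_eq[OF strict_mono_tau])
    finally show "t * tau 0 < tau (s * tau 0)" .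
  qed
  have inj: "inj_on \<phi> {0..<1}"
  proof (rule linorder_inj_onI)
    show "\<phi> s \<noteq> \<phi> t" if "s < t" "s \<in> {0..<1}" "t \<in> {0..<1}" for s t using neq[of s t] that by auto
  qed auto
  have closed: "closedin lattice_space (\<phi> ` C)" if C: "closed C" "C \<subseteq> {0..1}" for C
  proof -
    have "compact C" using C by (meson bounded_closed_interval bounded_subset compact_eq_bounded_closed)
    then have "compact ((\<lambda>t. t * tau 0) ` C)" by (intro compact_continuous_image continuous_intros)
    from closedin_crit_lattice_image[OF this] show ?thesis by (simp add: \<phi>_def image_image)
  qed
  show ?thesis
    using loop_to_circle[OF cont loop inj closed] cont loop im by auto
qed

end

theorem theorem1p6:
  fixes K :: "(real^2) set"
  assumes "bounded_convex_symmetric_domain K"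
    and "irreducible_domain K"
    and "\<not> open_parallelogram K"
  shows "\<exists>\<phi> :: real \<Rightarrow> (real^2) set.
    continuous_map (top_of_set {0..1}) lattice_space \<phi> \<and>
    \<phi> 0 = \<phi> 1 \<and>
    \<phi> ` {0..1} = critical_locus K \<and>
    (\<exists>\<psi> :: complex \<Rightarrow> (real^2) set.
      (\<forall>t\<in>{0..1}. \<psi> (cis (2 * pi * t)) = \<phi> t) \<and>
      homeomorphic_map (top_of_set (sphere 0 1))
        (subtopology lattice_space (critical_locus K)) \<psi>)"
proof -
  obtain N where N: "plane_norm N" "K = {x. N x < 1}"
    using domain_obtain_norm[OF assms(1)] by blast
  interpret irreducible_nonparallelogram N
    using N assms unfolding irreducible_nonparallelogram_def irreducible_nonparallelogram_axioms_def
      irreducible_norm_def irreducible_norm_axioms_def by simp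
  show ?thesis using critical_locus_circle unfolding N(2) .
qed

end
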